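(* Assume $0<\Delta_n\le 1$, $\Delta_n\to0$ and $n\Delta_n\to\infty$ as $n\to\infty$. Let $\theta\in\mathbb R$, $\sigma>0$, $\lambda>0$ and $z=(u,v,w)\in\mathbb R^3$, and set $\theta_n=\theta+\frac{u}{\sqrt{n\Delta_n}}$, $\sigma_n=\sigma+\frac{v}{\sqrt n}$, $\lambda_n=\lambda+\frac{w}{\sqrt{n\Delta_n}}$. Then, as $n\to\infty$, $$\log\frac{p(X^n;(\theta_n,\sigma_n,\lambda_n))}{p(X^n;(\theta,\sigma,\lambda))}\ \xrightarrow{\ \mathcal L(\mathbb P_x^{\theta,\sigma,\lambda})\ }\ z^{\mathsf T}\mathcal N(0,\Gamma(\theta,\sigma,\lambda))-\tfrac12 z^{\mathsf T}\Gamma(\theta,\sigma,\lambda)z,$$ where $\mathcal N(0,\Gamma)$ is a centered Gaussian vector in $\mathbb R^3$ with covariance matrix $$\Gamma(\theta,\sigma,\lambda)=\frac1{\sigma^2}\begin{pmatrix}1&0&-1\\0&2&0\\-1&0&1+\frac{\sigma^2}{\lambda}\end{pmatrix}.$$ That is, the LAN property holds at every $(\theta,\sigma,\lambda)$ with rates $(\sqrt{n\Delta_n},\sqrt n,\sqrt{n\Delta_n})$ and Fisher information $\Gamma(\theta,\sigma,\lambda)$.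
   Context: Let $B$ be a standard Brownian motion and $N$ an independent Poisson process with intensity $\lambda>0$. For $x\in\mathbb R$, $\theta\in\mathbb R$, $\sigma>0$, $\lambda>0$ the process is $X_t=x+\theta t+\sigma B_t+N_t-\lambda t$, $t\ge0$, and $\mathbb P_x^{\theta,\sigma,\lambda}$ denotes its law (the convergence in the claim is convergence in law under this measure). Observation times are $t_k=k\Delta_n$, $k=0,\dots,n$, and $X^n=(X_{t_0},\dots,X_{t_n})$. The transition density is $p^{\theta,\sigma,\lambda}(\Delta,x,y)=\sum_{m\ge0}e^{-\lambda\Delta}\frac{(\lambda\Delta)^m}{m!}(2\pi\sigma^2\Delta)^{-1/2}\exp\!\big(-\frac{(y-x-(\theta-\lambda)\Delta-m)^2}{2\sigma^2\Delta}\big)$ (the density of $x+\theta\Delta+\sigma B_\Delta+N_\Delta-\lambda\Delta$), and the likelihood of the observations is $p(X^n;(\theta,\sigma,\lambda))=\prod_{k=0}^{n-1}p^{\theta,\sigma,\lambda}(\Delta_n,X_{t_k},X_{t_{k+1}})$. *)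

theory Defs
  imports "HOL-Probability.Probability"
begin

definition bm_poisson ::
  "'a measure \<Rightarrow> (real \<Rightarrow> 'a \<Rightarrow> real) \<Rightarrow> (real \<Rightarrow> 'a \<Rightarrow> real) \<Rightarrow> real \<Rightarrow> bool" where
  "bm_poisson M B N lam \<longleftrightarrow>
     prob_space M \<and>
     (\<forall>t. B t \<in> borel_measurable M) \<and> (\<forall>t. N t \<in> borel_measurable M) \<and>
     (AE \<omega> in M. B 0 \<omega> = 0 \<and> N 0 \<omega> = 0) \<and>
     (AE \<omega> in M. continuous_on {0..} (\<lambda>t. B t \<omega>)) \<and>
     (AE \<omega> in M. (\<forall>t\<ge>0. N t \<omega> \<in> \<nat>) \<and> mono_on {0..} (\<lambda>t. N t \<omega>)
                   \<and> (\<forall>t\<ge>0. continuous (at_right t) (\<lambda>s. N s \<omega>))) \<and>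
     (\<forall>s t. 0 \<le> s \<and> s < t \<longrightarrow>
        distr M borel (\<lambda>\<omega>. B t \<omega> - B s \<omega>) = density lborel (normal_density 0 (sqrt (t - s)))) \<and>
     (\<forall>s t. 0 \<le> s \<and> s < t \<longrightarrow> (\<forall>k::nat.
        measure M {\<omega>\<in>space M. N t \<omega> - N s \<omega> = real k}
          = (lam * (t - s)) ^ k / fact k * exp (- lam * (t - s)))) \<and>
     (\<forall>(ts :: nat \<Rightarrow> real) m. 0 \<le> ts 0 \<and> (\<forall>i<m. ts i < ts (Suc i)) \<longrightarrow>
        prob_space.indep_vars M (\<lambda>_. borel)
          (\<lambda>j. case j of
                 Inl i \<Rightarrow> (\<lambda>\<omega>. B (ts (Suc i)) \<omega> - B (ts i) \<omega>)
               | Inr i \<Rightarrow> (\<lambda>\<omega>. N (ts (Suc i)) \<omega> - N (ts i) \<omega>))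
          ({..<m} <+> {..<m}))"

definition trans_dens :: "real \<Rightarrow> real \<Rightarrow> real \<Rightarrow> real \<Rightarrow> real \<Rightarrow> real \<Rightarrow> real" where
  "trans_dens \<theta> \<sigma> lam \<Delta> x y =
     (\<Sum>m. exp (- lam * \<Delta>) * (lam * \<Delta>) ^ m / fact m
            * (1 / sqrt (2 * pi * \<sigma>\<^sup>2 * \<Delta>))
            * exp (- (y - x - (\<theta> - lam) * \<Delta> - real m)\<^sup>2 / (2 * \<sigma>\<^sup>2 * \<Delta>)))"

definition likelihood :: "real \<Rightarrow> real \<Rightarrow> real \<Rightarrow> real \<Rightarrow> nat \<Rightarrow> (nat \<Rightarrow> real) \<Rightarrow> real" where
  "likelihood \<theta> \<sigma> lam \<Delta> n xs = (\<Prod>k<n. trans_dens \<theta> \<sigma> lam \<Delta> (xs k) (xs (Suc k)))"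

definition Fisher :: "real \<Rightarrow> real \<Rightarrow> nat \<Rightarrow> nat \<Rightarrow> real" where
  "Fisher \<sigma> lam i j = (1 / \<sigma>\<^sup>2) *
     (if i = 0 \<and> j = 0 then 1
      else if i = 0 \<and> j = 2 then -1
      else if i = 2 \<and> j = 0 then -1
      else if i = 1 \<and> j = 1 then 2
      else if i = 2 \<and> j = 2 then 1 + \<sigma>\<^sup>2 / lam
      else 0)"

definition quad_form :: "(nat \<Rightarrow> nat \<Rightarrow> real) \<Rightarrow> (nat \<Rightarrow> real) \<Rightarrow> real" where
  "quad_form G z = (\<Sum>i<3. \<Sum>j<3. z i * G i j * z j)"

text \<open>Law of z^T N(0,Gamma) - z^T Gamma z / 2, i.e. of sqrt q * G - q/2 with G standard
  normal and q = z^T Gamma z (z^T N(0,Gamma) is N(0,q); for q = 0 a point mass).\<close>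
definition lan_limit_law :: "real \<Rightarrow> real measure" where
  "lan_limit_law q = distr (density lborel std_normal_density) borel (\<lambda>g. sqrt q * g - q / 2)"

end

theory Submission
  imports Defs "HOL-Real_Asymp.Real_Asymp"
begin

text \<open>
  For fixed n the increments are i.i.d., so by Levy's continuity theorem it suffices to show
  \<open>n (E exp (i t ln r) - 1) \<longlonglongrightarrow> - (t\<^sup>2 + i t) q / 2\<close>, where \<open>r\<close> is the ratio of the two transition
  densities at one increment and \<open>q\<close> the quadratic form of the Fisher information. Since \<open>E r = 1\<close>, the
  term linear in \<open>r - 1\<close> drops out of \<open>E exp (i t ln r)\<close>, and the limit only depends on second moments
  of \<open>r - 1\<close>.

  The increment is a function of the unobserved pair \<open>(g, m)\<close> of the standardised Gaussian part and the
  number of jumps, and \<open>r\<close> is the conditional expectation, given the increment, of the explicit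
  likelihood ratio \<open>R\<close> of this pair. In \<open>L\<^sup>2\<close>, with errors \<open>o(1/n)\<close>, \<open>R - 1\<close> is the score \<open>S\<close> of the
  experiment in which the pair is observed, for which \<open>n E S\<^sup>2 \<longlonglongrightarrow> q\<close> and \<open>n E S\<^sup>4 \<longlonglongrightarrow> 0\<close>. Rounding
  the increment to the nearest integer recovers \<open>m\<close> unless the Gaussian part exceeds 1/2, so \<open>S\<close> is,
  again up to \<open>o(1/n)\<close>, a function of the increment. As conditional expectation is an \<open>L\<^sup>2\<close> contraction
  fixing such functions, \<open>r - 1\<close> is close to \<open>S\<close> as well.
\<close>

section \<open>Limits of sums of independent rows\<close>

lemma tendsto_mult_compose_at_0:
  fixes f g :: "'a :: real_normed_field \<Rightarrow> 'a"
  assumes ratio: "((\<lambda>h. f h / g h) \<longlongrightarrow> c) (at 0)" and f0: "f 0 = 0" and g0: "\<And>h. g h = 0 \<longleftrightarrow> h = 0"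
    and x: "(x \<longlongrightarrow> 0) F" and scaled: "((\<lambda>n. a n * g (x n)) \<longlongrightarrow> L) F"
  shows "((\<lambda>n. a n * f (x n)) \<longlongrightarrow> c * L) F"
proof -
  define q where "q h = (if h = 0 then c else f h / g h)" for h
  have "(q \<longlongrightarrow> c) (at 0)"
    using ratio by (rule Lim_transform_eventually) (auto simp: q_def eventually_at_filter)
  hence "isCont q 0"
    by (simp add: isCont_def q_def)
  hence "((\<lambda>n. q (x n)) \<longlongrightarrow> c) F"
    using isCont_tendsto_compose[OF _ x] by (fastforce simp: q_def)
  hence "((\<lambda>n. q (x n) * (a n * g (x n))) \<longlongrightarrow> c * L) F"
    using scaled by (rule tendsto_mult)
  moreover have "q h * (b * g h) = b * f h" for b h
    by (simp add: q_def f0 g0)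
  ultimately show ?thesis by simp
qed

lemma power_tendsto_exp:
  fixes \<phi> :: "nat \<Rightarrow> complex"
  assumes lim: "(\<lambda>n. of_nat n * (\<phi> n - 1)) \<longlonglongrightarrow> c"
  shows "(\<lambda>n. \<phi> n ^ n) \<longlonglongrightarrow> exp c"
proof -
  have "(\<lambda>n. inverse (of_nat n) * (of_nat n * (\<phi> n - 1))) \<longlonglongrightarrow> 0 * c"
    by (intro tendsto_mult lim lim_inverse_n)
  moreover have "\<forall>\<^sub>F n in sequentially. inverse (of_nat n) * (of_nat n * (\<phi> n - 1)) = \<phi> n - 1"
    using eventually_gt_at_top[of 0] by eventually_elim simp
  ultimately have \<phi>_lim: "(\<lambda>n. \<phi> n - 1) \<longlonglongrightarrow> 0"
    using Lim_transform_eventually by fastforce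
  have "((\<lambda>h::complex. Ln (1 + h) / h) \<longlongrightarrow> 1) (at 0)"
    using has_field_derivative_Ln[of 1] by (simp add: DERIV_def)
  hence "(\<lambda>n. of_nat n * Ln (1 + (\<phi> n - 1))) \<longlonglongrightarrow> 1 * c"
    using lim \<phi>_lim by (intro tendsto_mult_compose_at_0[where f="\<lambda>h. Ln (1 + h)" and g="\<lambda>h. h"]) auto
  hence "(\<lambda>n. exp (of_nat n * Ln (\<phi> n))) \<longlonglongrightarrow> exp c"
    by (intro tendsto_exp) simp
  moreover have "\<forall>\<^sub>F n in sequentially. \<phi> n \<noteq> 0"
    using tendsto_imp_eventually_ne[OF \<phi>_lim, of "-1"]
    by (auto elim!: eventually_mono)
  hence "\<forall>\<^sub>F n in sequentially. exp (of_nat n * Ln (\<phi> n)) = \<phi> n ^ n"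
    by eventually_elim (simp add: exp_of_nat_mult)
  ultimately show ?thesis by (rule Lim_transform_eventually)
qed

lemma weak_conv_m_cong_eventually:
  assumes "weak_conv_m \<mu> \<nu>" "\<forall>\<^sub>F n in sequentially. \<mu> n = \<mu>' n"
  shows "weak_conv_m \<mu>' \<nu>"
  unfolding weak_conv_m_def weak_conv_def
proof (intro allI impI)
  fix x assume "isCont (cdf \<nu>) x"
  with assms(1) have "(\<lambda>n. cdf (\<mu> n) x) \<longlonglongrightarrow> cdf \<nu> x"
    by (simp add: weak_conv_m_def weak_conv_def)
  thus "(\<lambda>n. cdf (\<mu>' n) x) \<longlonglongrightarrow> cdf \<nu> x"
    by (rule Lim_transform_eventually) (use assms(2) in eventually_elim, simp)
qed

lemma (in prob_space) weak_conv_m_row_sums: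
  fixes X :: "nat \<Rightarrow> nat \<Rightarrow> 'a \<Rightarrow> real"
  assumes indep: "\<And>n. indep_vars (\<lambda>_. borel) (X n) {..<n}"
    and distr: "\<And>n k. k < n \<Longrightarrow> distr M borel (X n k) = \<nu> n"
    and L: "real_distribution L"
    and lim: "\<And>t. (\<lambda>n. of_nat n * (char (\<nu> n) t - 1)) \<longlonglongrightarrow> \<psi> t"
    and char_L: "\<And>t. char L t = exp (\<psi> t)"
  shows "weak_conv_m (\<lambda>n. distr M borel (\<lambda>\<omega>. \<Sum>k<n. X n k \<omega>)) L"
proof (rule levy_continuity)
  have "random_variable borel (X n k)" if "k < n" for n k
    using indep[of n] that by (auto simp: indep_vars_def2)
  thus "real_distribution (distr M borel (\<lambda>\<omega>. \<Sum>k<n. X n k \<omega>))" for n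
    by (intro real_distribution_distr borel_measurable_sum) auto
  have "char (distr M borel (\<lambda>\<omega>. \<Sum>k<n. X n k \<omega>)) t = char (\<nu> n) t ^ n" for n t
    unfolding char_distr_sum[OF indep] by (simp add: distr)
  thus "(\<lambda>n. char (distr M borel (\<lambda>\<omega>. \<Sum>k<n. X n k \<omega>)) t) \<longlonglongrightarrow> char L t" for t
    unfolding char_L using power_tendsto_exp[OF lim] by simp
qed (rule L)

section \<open>Expansion of the characteristic function of a log-ratio\<close>

text \<open>\<open>lan_exponent t\<close> is the coefficient of \<open>D\<^sup>2\<close> in the expansion of \<open>(1 + D)\<close> to the power \<open>\<i> t\<close>.\<close>

definition lan_exponent :: "real \<Rightarrow> complex" where
  "lan_exponent t = - (of_real (t\<^sup>2) + \<i> * of_real t) / 2"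

definition iexp_ln_remainder :: "real \<Rightarrow> real \<Rightarrow> complex" where
  "iexp_ln_remainder t D = iexp (t * ln (1 + D)) - 1 - \<i> * of_real (t * D)"

lemma char_lan_limit_law:
  assumes "q \<ge> 0"
  shows "char (lan_limit_law q) t = exp (lan_exponent t * of_real q)"
proof -
  have "char (lan_limit_law q) t =
      (CLINT g|std_normal_distribution. iexp (- t * q / 2) * iexp ((t * sqrt q) * g))"
    unfolding lan_limit_law_def char_def
    by (subst integral_distr) (auto simp: exp_add[symmetric] algebra_simps)
  also have "\<dots> = iexp (- t * q / 2) * char std_normal_distribution (t * sqrt q)"
    unfolding char_def by (rule integral_mult_right_zero)
  also have "\<dots> = exp (\<i> * of_real (- t * q / 2) + of_real (- ((t * sqrt q)\<^sup>2) / 2))"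
    unfolding char_std_normal_distribution exp_of_real[symmetric] exp_add ..
  also have "\<i> * of_real (- t * q / 2) + of_real (- ((t * sqrt q)\<^sup>2) / 2) = lan_exponent t * of_real q"
    using assms by (simp add: lan_exponent_def power_mult_distrib field_simps)
  finally show ?thesis .
qed

lemma iexp_ln_remainder_tendsto:
  "((\<lambda>D. iexp_ln_remainder t D / of_real (D\<^sup>2)) \<longlongrightarrow> lan_exponent t) (at 0)"
proof -
  have cos: "((\<lambda>D. (cos (t * ln (1 + D)) - 1) / D\<^sup>2) \<longlongrightarrow> - t\<^sup>2 / 2) (at 0)"
    by (real_asymp; simp add: power2_eq_square)
  have "((\<lambda>D. (sin (s * ln (1 + D)) - s * D) / D\<^sup>2) \<longlongrightarrow> - s / 2) (at 0)" if "s \<noteq> 0" for s :: real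
    using that unfolding neq_iff by (elim disjE; real_asymp)
  hence sin: "((\<lambda>D. (sin (t * ln (1 + D)) - t * D) / D\<^sup>2) \<longlongrightarrow> - t / 2) (at 0)"
    by (cases "t = 0") auto
  have "Complex (- t\<^sup>2 / 2) (- t / 2) = lan_exponent t"
    by (simp add: complex_eq_iff lan_exponent_def)
  moreover have "Complex ((cos (t * ln (1 + D)) - 1) / D\<^sup>2) ((sin (t * ln (1 + D)) - t * D) / D\<^sup>2) =
      iexp_ln_remainder t D / of_real (D\<^sup>2)" for D
    by (simp add: complex_eq_iff Re_exp Im_exp Re_divide_of_real Im_divide_of_real iexp_ln_remainder_def
        del: of_real_power)
  ultimately show ?thesis
    using tendsto_Complex[OF cos sin] by simp
qed

lemma iexp_ln_remainder_near_0:
  assumes "\<epsilon> > 0"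
  obtains \<delta> where "\<delta> > 0"
    "\<And>D. \<bar>D\<bar> < \<delta> \<Longrightarrow> cmod (iexp_ln_remainder t D - lan_exponent t * of_real (D\<^sup>2)) \<le> \<epsilon> * D\<^sup>2"
proof -
  have "\<forall>\<^sub>F D in at 0. dist (iexp_ln_remainder t D / of_real (D\<^sup>2)) (lan_exponent t) < \<epsilon>"
    by (rule tendstoD[OF iexp_ln_remainder_tendsto assms])
  then obtain \<delta> where "\<delta> > 0"
    and near: "\<And>D. D \<noteq> 0 \<Longrightarrow> \<bar>D\<bar> < \<delta> \<Longrightarrow> cmod (iexp_ln_remainder t D / of_real (D\<^sup>2) - lan_exponent t) < \<epsilon>"
    unfolding eventually_at dist_norm by auto
  show thesis
  proof (rule that[OF \<open>\<delta> > 0\<close>])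
    fix D :: real assume D: "\<bar>D\<bar> < \<delta>"
    show "cmod (iexp_ln_remainder t D - lan_exponent t * of_real (D\<^sup>2)) \<le> \<epsilon> * D\<^sup>2"
    proof (cases "D = 0")
      case False
      have "iexp_ln_remainder t D - lan_exponent t * of_real (D\<^sup>2) =
          (iexp_ln_remainder t D / of_real (D\<^sup>2) - lan_exponent t) * of_real (D\<^sup>2)"
        using False by (simp add: field_simps)
      hence "cmod (iexp_ln_remainder t D - lan_exponent t * of_real (D\<^sup>2)) =
          cmod (iexp_ln_remainder t D / of_real (D\<^sup>2) - lan_exponent t) * D\<^sup>2"
        by (simp only: norm_mult norm_of_real abs_power2)
      also have "\<dots> \<le> \<epsilon> * D\<^sup>2"
        using near[OF False D] by (intro mult_right_mono) auto
      finally show ?thesis .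
    qed (simp add: iexp_ln_remainder_def)
  qed
qed

lemma iexp_ln_remainder_away_from_0:
  assumes "\<delta> > 0" "\<delta> \<le> \<bar>D\<bar>"
  shows "cmod (iexp_ln_remainder t D - lan_exponent t * of_real (D\<^sup>2))
    \<le> (2 / \<delta>\<^sup>2 + \<bar>t\<bar> / \<delta> + cmod (lan_exponent t)) * D\<^sup>2"
proof -
  have "cmod (iexp_ln_remainder t D) \<le> cmod (iexp (t * ln (1 + D)) - 1) + cmod (\<i> * of_real (t * D))"
    unfolding iexp_ln_remainder_def by (rule norm_triangle_ineq4)
  also have "\<dots> \<le> 2 + \<bar>t\<bar> * \<bar>D\<bar>"
    using norm_triangle_ineq4[of "iexp (t * ln (1 + D))" 1] by (simp add: norm_mult abs_mult)
  finally have "cmod (iexp_ln_remainder t D - lan_exponent t * of_real (D\<^sup>2))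
      \<le> 2 + \<bar>t\<bar> * \<bar>D\<bar> + cmod (lan_exponent t) * D\<^sup>2"
    using norm_triangle_ineq4[of "iexp_ln_remainder t D" "lan_exponent t * of_real (D\<^sup>2)"]
    by (simp add: norm_mult norm_power)
  moreover have "2 \<le> 2 / \<delta>\<^sup>2 * D\<^sup>2"
    using assms abs_le_square_iff[of \<delta> D] by (simp add: field_simps)
  moreover have "\<bar>t\<bar> * \<bar>D\<bar> \<le> \<bar>t\<bar> / \<delta> * D\<^sup>2"
  proof -
    have "\<bar>D\<bar> * \<delta> \<le> D\<^sup>2"
      using mult_left_mono[OF assms(2), of "\<bar>D\<bar>"] by (simp add: power2_eq_square)
    hence "\<bar>t\<bar> * (\<bar>D\<bar> * \<delta>) \<le> \<bar>t\<bar> * D\<^sup>2" by (rule mult_left_mono) simp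
    thus ?thesis using assms(1) by (simp add: field_simps)
  qed
  ultimately show ?thesis by (simp add: algebra_simps)
qed

lemma square_le_of_abs_ge:
  fixes D S \<delta> :: real
  assumes "\<delta> > 0" "\<delta> \<le> \<bar>D\<bar>"
  shows "D\<^sup>2 \<le> 4 * (D - S)\<^sup>2 + 16 / \<delta>\<^sup>2 * S ^ 4"
proof (cases "\<bar>S\<bar> \<le> \<bar>D - S\<bar>")
  case True
  hence "\<bar>D\<bar> \<le> \<bar>2 * (D - S)\<bar>" by (simp add: abs_mult)
  hence "D\<^sup>2 \<le> 4 * (D - S)\<^sup>2" by (simp only: abs_le_square_iff power_mult_distrib) simp
  moreover have "0 \<le> 16 / \<delta>\<^sup>2 * S ^ 4" by simp
  ultimately show ?thesis by linarith
next
  case False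
  hence "\<bar>D\<bar> \<le> \<bar>2 * S\<bar>" "\<bar>\<delta>\<bar> \<le> \<bar>2 * S\<bar>" using assms by (simp_all add: abs_mult)
  hence squares_le: "D\<^sup>2 \<le> 4 * S\<^sup>2" "\<delta>\<^sup>2 \<le> 4 * S\<^sup>2"
    by (simp_all only: abs_le_square_iff power_mult_distrib) simp_all
  hence "4 * S\<^sup>2 * \<delta>\<^sup>2 \<le> 4 * S\<^sup>2 * (4 * S\<^sup>2)"
    by (intro mult_left_mono) auto
  hence "4 * S\<^sup>2 \<le> 16 / \<delta>\<^sup>2 * S ^ 4"
    using assms(1) by (simp add: field_simps power4_eq_xxxx power2_eq_square)
  with squares_le(1) show ?thesis using zero_le_power2[of "D - S"] by linarith
qed

lemma iexp_ln_remainder_bound: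
  assumes "\<epsilon> > 0"
  obtains K where "\<And>D S. cmod (iexp_ln_remainder t D - lan_exponent t * of_real (D\<^sup>2))
    \<le> \<epsilon> * D\<^sup>2 + K * ((D - S)\<^sup>2 + S ^ 4)"
proof -
  obtain \<delta> where \<delta>: "\<delta> > 0" and near:
    "\<And>D. \<bar>D\<bar> < \<delta> \<Longrightarrow> cmod (iexp_ln_remainder t D - lan_exponent t * of_real (D\<^sup>2)) \<le> \<epsilon> * D\<^sup>2"
    using iexp_ln_remainder_near_0[OF assms, of t] by blast
  define A where "A = 2 / \<delta>\<^sup>2 + \<bar>t\<bar> / \<delta> + cmod (lan_exponent t)"
  define K where "K = A * max 4 (16 / \<delta>\<^sup>2)"
  have A_nonneg: "A \<ge> 0" using \<delta> by (simp add: A_def)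
  hence K_nonneg: "K \<ge> 0" by (simp add: K_def le_max_iff_disj)
  show thesis
  proof (rule that)
    fix D S :: real
    show "cmod (iexp_ln_remainder t D - lan_exponent t * of_real (D\<^sup>2)) \<le> \<epsilon> * D\<^sup>2 + K * ((D - S)\<^sup>2 + S ^ 4)"
    proof (cases "\<bar>D\<bar> < \<delta>")
      case True
      moreover have "0 \<le> K * ((D - S)\<^sup>2 + S ^ 4)" using K_nonneg by simp
      ultimately show ?thesis using near[of D] by linarith
    next
      case False
      hence D: "\<delta> \<le> \<bar>D\<bar>" by simp
      have "D\<^sup>2 \<le> 4 * (D - S)\<^sup>2 + 16 / \<delta>\<^sup>2 * S ^ 4"
        by (rule square_le_of_abs_ge[OF \<delta> D])
      also have "\<dots> \<le> max 4 (16 / \<delta>\<^sup>2) * ((D - S)\<^sup>2 + S ^ 4)"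
        unfolding distrib_left by (intro add_mono mult_right_mono) auto
      finally have "A * D\<^sup>2 \<le> K * ((D - S)\<^sup>2 + S ^ 4)"
        unfolding K_def mult.assoc by (rule mult_left_mono[OF _ A_nonneg])
      moreover have "0 \<le> \<epsilon> * D\<^sup>2" using assms by simp
      ultimately show ?thesis
        using iexp_ln_remainder_away_from_0[OF \<delta> D, of t] unfolding A_def by linarith
    qed
  qed
qed

lemma abs_diff_squares_le:
  fixes D S \<epsilon> :: real
  assumes "\<epsilon> > 0"
  shows "\<bar>D\<^sup>2 - S\<^sup>2\<bar> \<le> \<epsilon> * S\<^sup>2 + (1 + 1 / \<epsilon>) * (D - S)\<^sup>2"
proof -
  have "0 \<le> (\<epsilon> * S - (D - S))\<^sup>2 / \<epsilon>" "0 \<le> (\<epsilon> * S + (D - S))\<^sup>2 / \<epsilon>" using assms by simp_all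
  moreover have "(\<epsilon> * S - (D - S))\<^sup>2 / \<epsilon> = \<epsilon> * S\<^sup>2 + 1 / \<epsilon> * (D - S)\<^sup>2 - 2 * S * (D - S)"
    "(\<epsilon> * S + (D - S))\<^sup>2 / \<epsilon> = \<epsilon> * S\<^sup>2 + 1 / \<epsilon> * (D - S)\<^sup>2 + 2 * S * (D - S)"
    using assms by (simp_all add: field_simps power2_eq_square)
  moreover have "D\<^sup>2 - S\<^sup>2 = (D - S)\<^sup>2 + 2 * S * (D - S)"
    by (simp add: power2_eq_square algebra_simps)
  moreover have "0 \<le> (D - S)\<^sup>2" by simp
  ultimately show ?thesis unfolding distrib_right by linarith
qed

lemma tendsto_0_of_eps_bound:
  fixes x :: "'a \<Rightarrow> 'b :: real_normed_vector"
  assumes bound: "\<And>\<epsilon>::real. \<epsilon> > 0 \<Longrightarrow> \<exists>K. \<forall>\<^sub>F n in F. norm (x n) \<le> \<epsilon> * a n + K * b n"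
    and a: "(a \<longlongrightarrow> A) F" and b: "(b \<longlongrightarrow> 0) F"
  shows "(x \<longlongrightarrow> 0) F"
proof (rule tendstoI)
  fix e :: real assume e: "e > 0"
  define \<epsilon> where "\<epsilon> = e / (\<bar>A\<bar> + 1)"
  have \<epsilon>: "\<epsilon> > 0" using e by (simp add: \<epsilon>_def add_nonneg_pos)
  then obtain K where K: "\<forall>\<^sub>F n in F. norm (x n) \<le> \<epsilon> * a n + K * b n"
    using bound by blast
  have "((\<lambda>n. \<epsilon> * a n + K * b n) \<longlongrightarrow> \<epsilon> * A + K * 0) F"
    by (intro tendsto_intros a b)
  moreover have "\<epsilon> * A < \<epsilon> * (\<bar>A\<bar> + 1)"
    using \<epsilon> by (intro mult_strict_left_mono) auto
  hence "\<epsilon> * A + K * 0 < e"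
    by (simp add: \<epsilon>_def)
  ultimately have "\<forall>\<^sub>F n in F. \<epsilon> * a n + K * b n < e" by (rule order_tendstoD(2))
  with K show "\<forall>\<^sub>F n in F. dist (x n) 0 < e"
    by eventually_elim simp
qed

lemma integral_square_diff_triangle:
  fixes f g h :: "'a \<Rightarrow> real"
  assumes f: "f \<in> borel_measurable M" and h: "h \<in> borel_measurable M"
    and fg: "integrable M (\<lambda>x. (f x - g x)\<^sup>2)" and gh: "integrable M (\<lambda>x. (g x - h x)\<^sup>2)"
  shows "integrable M (\<lambda>x. (f x - h x)\<^sup>2)"
    and "(LINT x|M. (f x - h x)\<^sup>2) \<le> 2 * (LINT x|M. (f x - g x)\<^sup>2) + 2 * (LINT x|M. (g x - h x)\<^sup>2)"
proof -
  let ?bound = "\<lambda>x. 2 * (f x - g x)\<^sup>2 + 2 * (g x - h x)\<^sup>2"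
  have pointwise_le: "(f x - h x)\<^sup>2 \<le> ?bound x" for x
    using zero_le_power2[of "f x - 2 * g x + h x"] by (simp add: power2_eq_square algebra_simps)
  have bound_int: "integrable M ?bound"
    using fg gh by simp
  show diff_int: "integrable M (\<lambda>x. (f x - h x)\<^sup>2)"
  proof (rule Bochner_Integration.integrable_bound[OF bound_int])
    show "(\<lambda>x. (f x - h x)\<^sup>2) \<in> borel_measurable M"
      by (intro borel_measurable_power borel_measurable_diff f h)
    show "AE x in M. norm ((f x - h x)\<^sup>2) \<le> norm (?bound x)"
      using pointwise_le by simp
  qed
  have "(LINT x|M. (f x - h x)\<^sup>2) \<le> integral\<^sup>L M ?bound"
    by (rule integral_mono[OF diff_int bound_int pointwise_le])
  thus "(LINT x|M. (f x - h x)\<^sup>2) \<le> 2 * (LINT x|M. (f x - g x)\<^sup>2) + 2 * (LINT x|M. (g x - h x)\<^sup>2)"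
    using fg gh by simp
qed

lemma scaled_second_moment_tendsto:
  fixes P :: "nat \<Rightarrow> 'a measure" and D S :: "nat \<Rightarrow> 'a \<Rightarrow> real"
  assumes D: "\<And>n. D n \<in> borel_measurable (P n)"
    and S2: "\<And>n. integrable (P n) (\<lambda>x. (S n x)\<^sup>2)"
    and diff: "\<forall>\<^sub>F n in sequentially. integrable (P n) (\<lambda>x. (D n x - S n x)\<^sup>2)"
    and S2_lim: "(\<lambda>n. real n * (LINT x|P n. (S n x)\<^sup>2)) \<longlonglongrightarrow> q"
    and diff_lim: "(\<lambda>n. real n * (LINT x|P n. (D n x - S n x)\<^sup>2)) \<longlonglongrightarrow> 0"
  shows "(\<lambda>n. real n * (LINT x|P n. (D n x)\<^sup>2)) \<longlonglongrightarrow> q"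
proof -
  have "(\<lambda>n. real n * (LINT x|P n. (D n x)\<^sup>2) - real n * (LINT x|P n. (S n x)\<^sup>2)) \<longlonglongrightarrow> 0"
  proof (rule tendsto_0_of_eps_bound[OF _ S2_lim diff_lim], intro exI)
    fix \<epsilon> :: real assume \<epsilon>: "\<epsilon> > 0"
    show "\<forall>\<^sub>F n in sequentially. norm (real n * (LINT x|P n. (D n x)\<^sup>2) - real n * (LINT x|P n. (S n x)\<^sup>2))
      \<le> \<epsilon> * (real n * (LINT x|P n. (S n x)\<^sup>2)) + (1 + 1 / \<epsilon>) * (real n * (LINT x|P n. (D n x - S n x)\<^sup>2))"
      using diff
    proof eventually_elim
      case (elim n)
      have D2: "integrable (P n) (\<lambda>x. (D n x)\<^sup>2)"
        using integral_square_diff_triangle(1)[OF D _ elim, of "\<lambda>_. 0"] S2 by simp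
      have "\<bar>(LINT x|P n. (D n x)\<^sup>2) - (LINT x|P n. (S n x)\<^sup>2)\<bar> = \<bar>LINT x|P n. (D n x)\<^sup>2 - (S n x)\<^sup>2\<bar>"
        using D2 S2 by simp
      also have "\<dots> \<le> (LINT x|P n. \<bar>(D n x)\<^sup>2 - (S n x)\<^sup>2\<bar>)"
        by (rule integral_abs_bound)
      also have "\<dots> \<le> (LINT x|P n. \<epsilon> * (S n x)\<^sup>2 + (1 + 1 / \<epsilon>) * (D n x - S n x)\<^sup>2)"
        using D2 S2 elim abs_diff_squares_le[OF \<epsilon>] by (intro integral_mono) auto
      also have "\<dots> = \<epsilon> * (LINT x|P n. (S n x)\<^sup>2) + (1 + 1 / \<epsilon>) * (LINT x|P n. (D n x - S n x)\<^sup>2)"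
        using S2 elim by simp
      finally have "real n * \<bar>(LINT x|P n. (D n x)\<^sup>2) - (LINT x|P n. (S n x)\<^sup>2)\<bar> \<le> real n * \<dots>"
        by (rule mult_left_mono) simp
      moreover have "norm (real n * a - real n * b) = real n * \<bar>a - b\<bar>" for a b
        by (simp add: right_diff_distrib[symmetric] abs_mult)
      ultimately show ?case
        by (simp only: distrib_left mult.left_commute)
    qed
  qed
  from tendsto_add[OF this S2_lim] show ?thesis by simp
qed

lemma (in prob_space) expectation_iexp_ln_bound:
  assumes mean: "has_bochner_integral M D 0" and D2: "integrable M (\<lambda>x. (D x)\<^sup>2)"
    and S4: "integrable M (\<lambda>x. (S x) ^ 4)" and diff: "integrable M (\<lambda>x. (D x - S x)\<^sup>2)"
    and bound: "\<And>d s. cmod (iexp_ln_remainder t d - lan_exponent t * of_real (d\<^sup>2))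
      \<le> \<epsilon> * d\<^sup>2 + K * ((d - s)\<^sup>2 + s ^ 4)"
  shows "cmod ((CLINT x|M. iexp (t * ln (1 + D x))) - 1 - lan_exponent t * of_real (LINT x|M. (D x)\<^sup>2))
    \<le> \<epsilon> * (LINT x|M. (D x)\<^sup>2) + K * ((LINT x|M. (D x - S x)\<^sup>2) + (LINT x|M. (S x) ^ 4))"
proof -
  have D: "integrable M D" "expectation D = 0"
    using mean by (auto simp: has_bochner_integral_iff)
  hence [measurable]: "D \<in> borel_measurable M" by simp
  have iexp: "integrable M (\<lambda>x. iexp (t * ln (1 + D x)))"
    by (rule integrable_const_bound[where B=1]) auto
  have complex: "complex_integrable M (\<lambda>x. of_real (t * D x))" "complex_integrable M (\<lambda>x. of_real ((D x)\<^sup>2))"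
    using D D2 by (auto intro!: integrable_of_real simp del: of_real_mult of_real_power)
  have "(CLINT x|M. iexp_ln_remainder t (D x) - lan_exponent t * of_real ((D x)\<^sup>2)) =
      (CLINT x|M. iexp (t * ln (1 + D x))) - 1 - \<i> * (CLINT x|M. of_real (t * D x))
        - lan_exponent t * (CLINT x|M. of_real ((D x)\<^sup>2))"
    unfolding iexp_ln_remainder_def using iexp complex
    by (simp add: prob_space del: of_real_mult of_real_power)
  also have "\<dots> = (CLINT x|M. iexp (t * ln (1 + D x))) - 1 - lan_exponent t * of_real (LINT x|M. (D x)\<^sup>2)"
    unfolding integral_complex_of_real using D by simp
  finally have "cmod ((CLINT x|M. iexp (t * ln (1 + D x))) - 1 - lan_exponent t * of_real (LINT x|M. (D x)\<^sup>2)) =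
      cmod (CLINT x|M. iexp_ln_remainder t (D x) - lan_exponent t * of_real ((D x)\<^sup>2))" by simp
  also have "\<dots> \<le> (LINT x|M. \<epsilon> * (D x)\<^sup>2 + K * ((D x - S x)\<^sup>2 + (S x) ^ 4))"
    by (rule order_trans[OF integral_norm_bound integral_mono])
       (use iexp complex D2 S4 diff bound in
         \<open>auto simp: iexp_ln_remainder_def simp del: of_real_mult of_real_power\<close>)
  also have "\<dots> = \<epsilon> * (LINT x|M. (D x)\<^sup>2) + K * ((LINT x|M. (D x - S x)\<^sup>2) + (LINT x|M. (S x) ^ 4))"
    using D2 S4 diff by simp
  finally show ?thesis .
qed

lemma scaled_char_ln_tendsto:
  fixes P :: "nat \<Rightarrow> 'a measure" and D S :: "nat \<Rightarrow> 'a \<Rightarrow> real"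
  assumes P: "\<And>n. prob_space (P n)" and D: "\<And>n. D n \<in> borel_measurable (P n)"
    and S2: "\<And>n. integrable (P n) (\<lambda>x. (S n x)\<^sup>2)" and S4: "\<And>n. integrable (P n) (\<lambda>x. (S n x) ^ 4)"
    and mean: "\<forall>\<^sub>F n in sequentially. has_bochner_integral (P n) (D n) 0"
    and diff: "\<forall>\<^sub>F n in sequentially. integrable (P n) (\<lambda>x. (D n x - S n x)\<^sup>2)"
    and S2_lim: "(\<lambda>n. real n * (LINT x|P n. (S n x)\<^sup>2)) \<longlonglongrightarrow> q"
    and S4_lim: "(\<lambda>n. real n * (LINT x|P n. (S n x) ^ 4)) \<longlonglongrightarrow> 0"
    and diff_lim: "(\<lambda>n. real n * (LINT x|P n. (D n x - S n x)\<^sup>2)) \<longlonglongrightarrow> 0"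
  shows "(\<lambda>n. of_nat n * ((CLINT x|P n. iexp (t * ln (1 + D n x))) - 1)) \<longlonglongrightarrow> lan_exponent t * of_real q"
proof -
  define E where "E n = (CLINT x|P n. iexp (t * ln (1 + D n x))) - 1" for n
  define V where "V n = (LINT x|P n. (D n x)\<^sup>2)" for n
  define e where "e n = (LINT x|P n. (D n x - S n x)\<^sup>2) + (LINT x|P n. (S n x) ^ 4)" for n
  have V_lim: "(\<lambda>n. real n * V n) \<longlonglongrightarrow> q"
    unfolding V_def by (rule scaled_second_moment_tendsto[OF D S2 diff S2_lim diff_lim])
  have e_lim: "(\<lambda>n. real n * e n) \<longlonglongrightarrow> 0"
    unfolding e_def distrib_left using tendsto_add[OF diff_lim S4_lim] by simp
  have "(\<lambda>n. of_nat n * (E n - lan_exponent t * of_real (V n))) \<longlonglongrightarrow> 0"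
  proof (rule tendsto_0_of_eps_bound[OF _ V_lim e_lim])
    fix \<epsilon> :: real assume \<epsilon>: "\<epsilon> > 0"
    obtain K where bound: "\<And>d s. cmod (iexp_ln_remainder t d - lan_exponent t * of_real (d\<^sup>2))
        \<le> \<epsilon> * d\<^sup>2 + K * ((d - s)\<^sup>2 + s ^ 4)"
      by (rule iexp_ln_remainder_bound[OF \<epsilon>, of t]) blast
    have "\<forall>\<^sub>F n in sequentially. cmod (of_nat n * (E n - lan_exponent t * of_real (V n)))
      \<le> \<epsilon> * (real n * V n) + K * (real n * e n)"
      using mean diff
    proof eventually_elim
      case (elim n)
      have D2: "integrable (P n) (\<lambda>x. (D n x)\<^sup>2)"
        using integral_square_diff_triangle(1)[OF D _ elim(2), of "\<lambda>_. 0"] S2 by simp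
      have "cmod (E n - lan_exponent t * of_real (V n)) \<le> \<epsilon> * V n + K * e n"
        unfolding E_def V_def e_def
        by (rule prob_space.expectation_iexp_ln_bound[OF P elim(1) D2 S4 elim(2) bound])
      from mult_left_mono[OF this, of "real n"] show ?case
        by (simp add: norm_mult distrib_left mult.left_commute)
    qed
    thus "\<exists>K. \<forall>\<^sub>F n in sequentially. cmod (of_nat n * (E n - lan_exponent t * of_real (V n)))
      \<le> \<epsilon> * (real n * V n) + K * (real n * e n)" ..
  qed
  moreover have "(\<lambda>n. lan_exponent t * of_real (real n * V n)) \<longlonglongrightarrow> lan_exponent t * of_real q"
    by (intro tendsto_intros V_lim)
  ultimately have
    "(\<lambda>n. of_nat n * (E n - lan_exponent t * of_real (V n)) + lan_exponent t * of_real (real n * V n))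
      \<longlonglongrightarrow> 0 + lan_exponent t * of_real q" by (rule tendsto_add)
  thus ?thesis by (simp add: E_def algebra_simps)
qed

section \<open>Densities of image measures\<close>

locale image_density = prob_space M for M :: "'a measure" +
  fixes N :: "'b measure" and T :: "'a \<Rightarrow> 'b" and R :: "'a \<Rightarrow> real" and r :: "'b \<Rightarrow> real"
  assumes T [measurable]: "T \<in> measurable M N"
    and r [measurable]: "r \<in> borel_measurable N"
    and R: "integrable M R"
    and R_nonneg: "\<And>x. R x \<ge> 0" and r_nonneg: "\<And>y. r y \<ge> 0"
    and distr_density: "distr (density M R) N T = density (distr M N T) r"
begin

lemma R_measurable [measurable]: "R \<in> borel_measurable M"
  using R by simp

lemma nn_integral_indicator_image_density:
  assumes [measurable]: "A \<in> sets N"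
  shows "(\<integral>\<^sup>+x. ennreal (r (T x) * indicator A (T x)) \<partial>M) = (\<integral>\<^sup>+x. ennreal (R x * indicator A (T x)) \<partial>M)"
proof -
  have "(\<integral>\<^sup>+x. ennreal (r (T x) * indicator A (T x)) \<partial>M) = (\<integral>\<^sup>+y. indicator A y \<partial>density (distr M N T) r)"
    by (simp add: nn_integral_density nn_integral_distr ennreal_mult' ennreal_indicator r_nonneg
        del: nn_integral_indicator)
  also have "\<dots> = (\<integral>\<^sup>+x. ennreal (R x * indicator A (T x)) \<partial>M)"
    unfolding distr_density[symmetric]
    by (simp add: nn_integral_density nn_integral_distr ennreal_mult' ennreal_indicator R_nonneg
        del: nn_integral_indicator)
  finally show ?thesis .
qed

lemma has_bochner_integral_image_density: "has_bochner_integral M (\<lambda>x. r (T x)) (LINT x|M. R x)"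
proof (rule has_bochner_integral_nn_integral)
  have "(\<integral>\<^sup>+x. ennreal (r (T x)) \<partial>M) = (\<integral>\<^sup>+x. ennreal (r (T x) * indicator (space N) (T x)) \<partial>M)"
    using measurable_space[OF T] by (intro nn_integral_cong) simp
  also have "\<dots> = (\<integral>\<^sup>+x. ennreal (R x) \<partial>M)"
    unfolding nn_integral_indicator_image_density[OF sets.top]
    using measurable_space[OF T] by (intro nn_integral_cong) simp
  finally show "(\<integral>\<^sup>+x. ennreal (r (T x)) \<partial>M) = ennreal (LINT x|M. R x)"
    using R R_nonneg by (simp add: nn_integral_eq_integral)
qed (simp_all add: r_nonneg R_nonneg)

abbreviation image_algebra :: "'a measure" where
  "image_algebra \<equiv> vimage_algebra (space M) T N"

lemma finite_measure_subalgebra_image_algebra: "finite_measure_subalgebra M image_algebra"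
  by unfold_locales (simp add: subalgebra_def sets_image_in_sets[OF _ T])

lemma measurable_image_algebra:
  assumes "f \<in> borel_measurable N"
  shows "(\<lambda>x. f (T x) :: real) \<in> borel_measurable image_algebra"
  using T by (intro measurable_compose[OF measurable_vimage_algebra1 assms]) (auto simp: measurable_def)

lemma AE_cond_exp_image_density: "AE x in M. real_cond_exp M image_algebra R x = r (T x)"
proof -
  interpret finite_measure_subalgebra M image_algebra by (rule finite_measure_subalgebra_image_algebra)
  have r_int: "integrable M (\<lambda>x. r (T x))"
    using has_bochner_integral_image_density by (simp add: has_bochner_integral_iff)
  show ?thesis
  proof (rule real_cond_exp_charact[OF _ R r_int measurable_image_algebra[OF r]])
    fix B assume "B \<in> sets image_algebra"
    then obtain A where [measurable]: "A \<in> sets N" and B: "B = T -` A \<inter> space M"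
      using T by (auto simp: sets_vimage_algebra2 measurable_def)
    have "(LINT x:B|M. f x) = enn2real (\<integral>\<^sup>+x. ennreal (f x * indicator A (T x)) \<partial>M)"
      if [measurable]: "f \<in> borel_measurable M" and nonneg: "\<And>x. f x \<ge> 0" for f :: "'a \<Rightarrow> real"
      unfolding set_lebesgue_integral_def B
      by (subst integral_eq_nn_integral)
         (auto simp: nonneg indicator_def intro!: arg_cong[where f=enn2real] nn_integral_cong)
    thus "(LINT x:B|M. R x) = (LINT x:B|M. r (T x))"
      using R_nonneg r_nonneg nn_integral_indicator_image_density[of A] by simp
  qed
qed

lemma image_density_L2_contraction:
  assumes [measurable]: "h \<in> borel_measurable N" and L2: "integrable M (\<lambda>x. (R x - h (T x))\<^sup>2)"
  shows "integrable M (\<lambda>x. (r (T x) - h (T x))\<^sup>2)"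
    and "(LINT x|M. (r (T x) - h (T x))\<^sup>2) \<le> (LINT x|M. (R x - h (T x))\<^sup>2)"
proof -
  interpret finite_measure_subalgebra M image_algebra by (rule finite_measure_subalgebra_image_algebra)
  let ?D = "\<lambda>x. R x - h (T x)" and ?E = "real_cond_exp M image_algebra"
  have D: "integrable M ?D"
    by (rule square_integrable_imp_integrable[OF _ L2]) measurable
  hence h: "integrable M (\<lambda>x. h (T x))"
    using Bochner_Integration.integrable_diff[OF R D] by simp
  have "AE x in M. ?E ?D x = ?E R x - ?E (\<lambda>x. h (T x)) x"
    by (rule real_cond_exp_diff[OF R h])
  with AE_cond_exp_image_density real_cond_exp_F_meas[OF h measurable_image_algebra]
  have cond_exp_D: "AE x in M. ?E ?D x = r (T x) - h (T x)"
    by (auto elim: eventually_elim2)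
  have jensen: "AE x in M. (?E ?D x)\<^sup>2 \<le> ?E (\<lambda>x. (?D x)\<^sup>2) x"
    by (rule real_cond_exp_jensens_inequality[OF D _ _ L2, where I=UNIV]) (auto simp: convex_power2)
  have square_integrable: "integrable M (\<lambda>x. (?E ?D x)\<^sup>2)"
    by (rule integrable_convex_cond_exp[OF D _ _ L2, where I=UNIV]) (auto simp: convex_power2)
  have cond_exp_square: "AE x in M. (?E ?D x)\<^sup>2 = (r (T x) - h (T x))\<^sup>2"
    using cond_exp_D by eventually_elim simp
  show "integrable M (\<lambda>x. (r (T x) - h (T x))\<^sup>2)"
    using square_integrable by (subst integrable_cong_AE[OF _ _ cond_exp_square, symmetric]) measurable
  have "(LINT x|M. (r (T x) - h (T x))\<^sup>2) = (LINT x|M. (?E ?D x)\<^sup>2)"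
    by (rule integral_cong_AE[OF _ _ AE_symmetric[OF cond_exp_square]]) measurable
  also have "\<dots> \<le> (LINT x|M. ?E (\<lambda>x. (?D x)\<^sup>2) x)"
    by (rule integral_mono_AE[OF square_integrable real_cond_exp_int(1)[OF L2] jensen])
  also have "\<dots> = (LINT x|M. (?D x)\<^sup>2)"
    by (rule real_cond_exp_int(2)[OF L2])
  finally show "(LINT x|M. (r (T x) - h (T x))\<^sup>2) \<le> (LINT x|M. (R x - h (T x))\<^sup>2)" .
qed

lemma image_density_L2_error:
  assumes [measurable]: "U \<in> borel_measurable M" "h \<in> borel_measurable N"
    and R_U: "integrable M (\<lambda>x. (R x - U x)\<^sup>2)" and U_h: "integrable M (\<lambda>x. (U x - h (T x))\<^sup>2)"
  shows "integrable M (\<lambda>x. (r (T x) - U x)\<^sup>2)"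
    and "(LINT x|M. (r (T x) - U x)\<^sup>2) \<le> 4 * (LINT x|M. (R x - U x)\<^sup>2) + 6 * (LINT x|M. (U x - h (T x))\<^sup>2)"
proof -
  have hT [measurable]: "(\<lambda>x. h (T x)) \<in> borel_measurable M" by measurable
  have rT [measurable]: "(\<lambda>x. r (T x)) \<in> borel_measurable M" by measurable
  have sym: "(h (T x) - U x)\<^sup>2 = (U x - h (T x))\<^sup>2" for x
    by (rule power2_commute)
  note R_h = integral_square_diff_triangle[OF R_measurable hT R_U U_h]
  note r_h = image_density_L2_contraction[OF assms(2) R_h(1)]
  note r_U = integral_square_diff_triangle[OF rT assms(1) r_h(1), unfolded sym, OF U_h]
  show "integrable M (\<lambda>x. (r (T x) - U x)\<^sup>2)"
    by (rule r_U(1))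
  show "(LINT x|M. (r (T x) - U x)\<^sup>2) \<le> 4 * (LINT x|M. (R x - U x)\<^sup>2) + 6 * (LINT x|M. (U x - h (T x))\<^sup>2)"
    using R_h(2) r_h(2) r_U(2) by linarith
qed

end

section \<open>Gaussian and Poisson moments\<close>

lemma has_bochner_integral_density_iff:
  fixes f g :: "'a \<Rightarrow> real"
  assumes "f \<in> borel_measurable M" "g \<in> borel_measurable M" "\<And>x. g x \<ge> 0"
  shows "has_bochner_integral (density M g) f I \<longleftrightarrow> has_bochner_integral M (\<lambda>x. g x * f x) I"
  using assms by (simp add: has_bochner_integral_iff integrable_density integral_density)

lemma has_bochner_integral_pair_mult:
  fixes f :: "'a \<Rightarrow> real" and k :: "'b \<Rightarrow> real"
  assumes "sigma_finite_measure M1" "sigma_finite_measure M2"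
    and f: "has_bochner_integral M1 f I" and k: "has_bochner_integral M2 k J"
  shows "has_bochner_integral (M1 \<Otimes>\<^sub>M M2) (\<lambda>z. f (fst z) * k (snd z)) (I * J)"
proof -
  interpret M1: sigma_finite_measure M1 by fact
  interpret M2: sigma_finite_measure M2 by fact
  interpret pair_sigma_finite M1 M2 ..
  have f_int: "integrable M1 f" "integral\<^sup>L M1 f = I" and k_int: "integrable M2 k" "integral\<^sup>L M2 k = J"
    using f k by (auto simp: has_bochner_integral_iff)
  hence [measurable]: "f \<in> borel_measurable M1" "k \<in> borel_measurable M2" by auto
  have prod_int: "integrable (M1 \<Otimes>\<^sub>M M2) (\<lambda>z. f (fst z) * k (snd z))"
    by (rule Fubini_integrable) (use f_int k_int in \<open>auto simp: abs_mult\<close>)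
  show ?thesis
    using integral_fst'[OF prod_int] prod_int f_int k_int by (simp add: has_bochner_integral_iff)
qed

lemma std_normal_moments:
  shows std_normal_moment_1: "has_bochner_integral std_normal_distribution (\<lambda>x. x) 0"
    and std_normal_moment_2: "has_bochner_integral std_normal_distribution (\<lambda>x. x\<^sup>2) 1"
    and std_normal_moment_3: "has_bochner_integral std_normal_distribution (\<lambda>x. x ^ 3) 0"
    and std_normal_moment_4: "has_bochner_integral std_normal_distribution (\<lambda>x. x ^ 4) 3"
    and std_normal_moment_6: "has_bochner_integral std_normal_distribution (\<lambda>x. x ^ 6) 15"
    and std_normal_moment_8: "has_bochner_integral std_normal_distribution (\<lambda>x. x ^ 8) 105"
proof -
  have even: "has_bochner_integral std_normal_distribution (\<lambda>x. x ^ (2 * k))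
      (fact (2 * k) / (2 ^ k * fact k))" for k
    using std_normal_distribution_even_moments by (simp add: has_bochner_integral_iff)
  have odd: "has_bochner_integral std_normal_distribution (\<lambda>x. x ^ k) 0" if "odd k" for k
    using that integrable_std_normal_distribution_moment integral_std_normal_distribution_moment_odd
    by (simp add: has_bochner_integral_iff)
  show "has_bochner_integral std_normal_distribution (\<lambda>x. x) 0"
    "has_bochner_integral std_normal_distribution (\<lambda>x. x ^ 3) 0"
    using odd[of 1] odd[of 3] by simp_all
  show "has_bochner_integral std_normal_distribution (\<lambda>x. x\<^sup>2) 1"
    "has_bochner_integral std_normal_distribution (\<lambda>x. x ^ 4) 3"
    "has_bochner_integral std_normal_distribution (\<lambda>x. x ^ 6) 15"
    "has_bochner_integral std_normal_distribution (\<lambda>x. x ^ 8) 105"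
    using even[of 1] even[of 2] even[of 3] even[of 4] by (simp_all add: fact_numeral)
qed

lemma
  assumes "s > 0"
  shows normal_moment_1: "has_bochner_integral (density lborel (normal_density \<delta> s)) (\<lambda>x. x) \<delta>"
    and normal_moment_2: "has_bochner_integral (density lborel (normal_density \<delta> s)) (\<lambda>x. x\<^sup>2) (s\<^sup>2 + \<delta>\<^sup>2)"
proof -
  have mass: "has_bochner_integral lborel (normal_density \<delta> s) 1"
    using normal_moment_even[OF assms, of \<delta> 0] by simp
  have mean: "has_bochner_integral lborel (\<lambda>x. normal_density \<delta> s x * (x - \<delta>)) 0"
    using normal_moment_odd[OF assms, of \<delta> 0] by simp
  have variance: "has_bochner_integral lborel (\<lambda>x. normal_density \<delta> s x * (x - \<delta>)\<^sup>2) (s\<^sup>2)"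
    using normal_moment_even[OF assms, of \<delta> 1] by simp
  have "has_bochner_integral lborel
      (\<lambda>x. normal_density \<delta> s x * (x - \<delta>)\<^sup>2 +
        (2 * \<delta> * (normal_density \<delta> s x * (x - \<delta>)) + \<delta>\<^sup>2 * normal_density \<delta> s x))
      (s\<^sup>2 + (2 * \<delta> * 0 + \<delta>\<^sup>2 * 1))"
    by (intro has_bochner_integral_add has_bochner_integral_mult_right mass mean variance)
  hence "has_bochner_integral lborel (\<lambda>x. normal_density \<delta> s x * x\<^sup>2) (s\<^sup>2 + \<delta>\<^sup>2)"
    by (simp add: power2_eq_square algebra_simps)
  thus "has_bochner_integral (density lborel (normal_density \<delta> s)) (\<lambda>x. x\<^sup>2) (s\<^sup>2 + \<delta>\<^sup>2)"
    by (simp add: has_bochner_integral_density_iff)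
  show "has_bochner_integral (density lborel (normal_density \<delta> s)) (\<lambda>x. x) \<delta>"
    using normal_moment_nz_1[OF assms] by (simp add: has_bochner_integral_density_iff)
qed

lemma normal_density_square_div_std:
  assumes s: "s > 0" "s\<^sup>2 < 2"
  defines "v \<equiv> 2 - s\<^sup>2"
  shows "normal_density \<delta> s x * (normal_density \<delta> s x / std_normal_density x) =
    exp (\<delta>\<^sup>2 / v) / (s * sqrt v) * normal_density (2 * \<delta> / v) (s / sqrt v) x"
proof -
  have v: "v > 0" "s\<^sup>2 = 2 - v" using s by (simp_all add: v_def)
  have sqrt_s: "sqrt (2 * pi * s\<^sup>2) = sqrt (2 * pi) * s"
    "sqrt (2 * pi * (s / sqrt v)\<^sup>2) = sqrt (2 * pi) * (s / sqrt v)"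
    using s(1) v(1) by (simp_all add: real_sqrt_mult)
  have "(x - 2 * \<delta> / v)\<^sup>2 / (2 * (s / sqrt v)\<^sup>2) = (v * x - 2 * \<delta>)\<^sup>2 / (2 * s\<^sup>2 * v)"
    using v(1) s by (simp add: field_simps power2_eq_square)
  also have "(v * x - 2 * \<delta>)\<^sup>2 = 2 * s\<^sup>2 * \<delta>\<^sup>2 + 2 * v * (x - \<delta>)\<^sup>2 - s\<^sup>2 * v * x\<^sup>2"
    unfolding v(2) by (simp add: power2_eq_square algebra_simps)
  also have "\<dots> / (2 * s\<^sup>2 * v) = \<delta>\<^sup>2 / v + (x - \<delta>)\<^sup>2 / s\<^sup>2 - x\<^sup>2 / 2"
    using v(1) s(1) by (simp add: diff_divide_distrib add_divide_distrib)
  finally have exponent: "2 * (- (x - \<delta>)\<^sup>2 / (2 * s\<^sup>2)) - (- x\<^sup>2 / 2) =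
      \<delta>\<^sup>2 / v + (- (x - 2 * \<delta> / v)\<^sup>2 / (2 * (s / sqrt v)\<^sup>2))"
    by simp
  have "normal_density \<delta> s x * (normal_density \<delta> s x / std_normal_density x) =
      exp (2 * (- (x - \<delta>)\<^sup>2 / (2 * s\<^sup>2)) - (- x\<^sup>2 / 2)) / (sqrt (2 * pi) * s\<^sup>2)"
    unfolding normal_density_def sqrt_s exp_diff exp_double
    using s(1) by (simp add: field_simps power2_eq_square)
  also have "\<dots> = exp (\<delta>\<^sup>2 / v) / (s * sqrt v) * normal_density (2 * \<delta> / v) (s / sqrt v) x"
    unfolding exponent normal_density_def sqrt_s exp_add
    using s(1) v(1) by (simp add: field_simps power2_eq_square)
  finally show ?thesis .
qed

lemma normal_ratio_moment:
  assumes s: "s > 0" "s\<^sup>2 < 2"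
  shows "has_bochner_integral (density lborel (normal_density \<delta> s))
    (\<lambda>x. normal_density \<delta> s x / std_normal_density x)
    (exp (\<delta>\<^sup>2 / (2 - s\<^sup>2)) / (s * sqrt (2 - s\<^sup>2)))"
proof -
  define v where "v = 2 - s\<^sup>2"
  have "has_bochner_integral lborel (normal_density (2 * \<delta> / v) (s / sqrt v)) 1"
    using normal_moment_even[of "s / sqrt v" "2 * \<delta> / v" 0] s by (simp add: v_def)
  from has_bochner_integral_mult_right[OF this, of "exp (\<delta>\<^sup>2 / v) / (s * sqrt v)"] show ?thesis
    using normal_density_square_div_std[OF s] by (simp add: has_bochner_integral_density_iff v_def)
qed

lemma distr_normal_affine:
  assumes "s > 0" "\<tau> > 0"
  shows "distr (density lborel (normal_density \<delta> s)) borel (\<lambda>x. d + \<tau> * x) =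
    density lborel (normal_density (d + \<tau> * \<delta>) (\<tau> * s))"
proof -
  interpret prob_space "density lborel (normal_density \<delta> s)"
    using assms by (intro prob_space_normal_density)
  have "distr (density lborel (normal_density \<delta> s)) lborel (\<lambda>x. x) =
      distr (density lborel (normal_density \<delta> s)) (density lborel (normal_density \<delta> s)) (\<lambda>x. x)"
    by (rule distr_cong) auto
  hence "distributed (density lborel (normal_density \<delta> s)) lborel (\<lambda>x. x) (normal_density \<delta> s)"
    by (simp add: distributed_def)
  from normal_density_affine[OF this, of \<tau> d] assms
  have "distr (density lborel (normal_density \<delta> s)) lborel (\<lambda>x. d + \<tau> * x) =
      density lborel (normal_density (d + \<tau> * \<delta>) (\<tau> * s))"
    by (simp add: distributed_def)
  thus ?thesis by (metis distr_cong sets_lborel)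
qed

lemma has_bochner_integral_pmf_nat_iff:
  fixes f :: "nat \<Rightarrow> real"
  shows "has_bochner_integral (measure_pmf p) f I \<longleftrightarrow>
    summable (\<lambda>m. \<bar>pmf p m * f m\<bar>) \<and> (\<lambda>m. pmf p m * f m) sums I"
proof -
  have integrable_iff: "integrable (measure_pmf p) f \<longleftrightarrow> summable (\<lambda>m. \<bar>pmf p m * f m\<bar>)"
    by (simp add: measure_pmf_eq_density integrable_density integrable_count_space_nat_iff)
  have "(\<lambda>m. pmf p m * f m) sums (integral\<^sup>L (measure_pmf p) f)" if "integrable (measure_pmf p) f"
  proof -
    have "integrable (count_space UNIV) (\<lambda>m. pmf p m * f m)"
      using that unfolding integrable_iff by (simp add: integrable_count_space_nat_iff)
    from sums_integral_count_space_nat[OF this] show ?thesis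
      by (simp add: measure_pmf_eq_density integral_density)
  qed
  thus ?thesis
    unfolding has_bochner_integral_iff using integrable_iff sums_unique2 by blast
qed

lemma poisson_generating_function:
  assumes "\<mu> > 0"
  shows "has_bochner_integral (measure_pmf (poisson_pmf \<mu>)) (\<lambda>m. \<rho> ^ m) (exp (\<mu> * (\<rho> - 1)))"
proof -
  have weight: "pmf (poisson_pmf \<mu>) m * \<rho> ^ m = exp (- \<mu>) * ((\<mu> * \<rho>) ^ m /\<^sub>R fact m)" for m
    using assms by (simp add: power_mult_distrib field_simps)
  have "(\<lambda>m. exp (- \<mu>) * ((\<mu> * \<rho>) ^ m /\<^sub>R fact m)) sums (exp (- \<mu>) * exp (\<mu> * \<rho>))"
    by (intro sums_mult exp_converges)
  moreover have "exp (- \<mu>) * exp (\<mu> * \<rho>) = exp (\<mu> * (\<rho> - 1))"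
    by (simp add: exp_add[symmetric] algebra_simps)
  moreover have "summable (\<lambda>m. exp (- \<mu>) * norm ((\<mu> * \<rho>) ^ m /\<^sub>R fact m))"
    by (intro summable_mult summable_norm_exp)
  ultimately show ?thesis
    unfolding has_bochner_integral_pmf_nat_iff weight by (simp add: abs_mult)
qed

lemma poisson_ratio_moment:
  assumes \<mu>: "\<mu> > 0" and \<nu>: "\<nu> > 0"
  shows "has_bochner_integral (measure_pmf (poisson_pmf \<nu>))
    (\<lambda>m. pmf (poisson_pmf \<nu>) m / pmf (poisson_pmf \<mu>) m)
    (exp ((\<nu> - \<mu>)\<^sup>2 / \<mu>))"
proof -
  have "pmf (poisson_pmf \<nu>) m / pmf (poisson_pmf \<mu>) m = exp (\<mu> - \<nu>) * (\<nu> / \<mu>) ^ m" for m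
    using \<mu> \<nu> by (simp add: field_simps exp_diff exp_minus power_divide)
  moreover have "exp (\<mu> - \<nu>) * exp (\<nu> * (\<nu> / \<mu> - 1)) = exp ((\<nu> - \<mu>)\<^sup>2 / \<mu>)"
    using \<mu> unfolding exp_add[symmetric] exp_inj_iff by (simp add: field_simps power2_eq_square)
  ultimately show ?thesis
    using has_bochner_integral_mult_right[OF poisson_generating_function[OF \<nu>, of "\<nu> / \<mu>"], of "exp (\<mu> - \<nu>)"]
    by simp
qed

lemma has_bochner_integral_poisson_mult:
  fixes f :: "nat \<Rightarrow> real"
  assumes \<mu>: "\<mu> > 0" and f: "has_bochner_integral (measure_pmf (poisson_pmf \<mu>)) (\<lambda>m. f (Suc m)) I"
  shows "has_bochner_integral (measure_pmf (poisson_pmf \<mu>)) (\<lambda>m. real m * f m) (\<mu> * I)"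
proof -
  have shift: "pmf (poisson_pmf \<mu>) (Suc m) * (real (Suc m) * f (Suc m)) =
      \<mu> * (pmf (poisson_pmf \<mu>) m * f (Suc m))" for m
    using \<mu> by (simp add: field_simps del: of_nat_Suc)
  from f have abs_summable: "summable (\<lambda>m. \<bar>pmf (poisson_pmf \<mu>) m * f (Suc m)\<bar>)"
    and sums: "(\<lambda>m. pmf (poisson_pmf \<mu>) m * f (Suc m)) sums I"
    unfolding has_bochner_integral_pmf_nat_iff by auto
  have "summable (\<lambda>m. \<bar>pmf (poisson_pmf \<mu>) (Suc m) * (real (Suc m) * f (Suc m))\<bar>)"
    unfolding shift abs_mult[of \<mu>] using abs_summable by (rule summable_mult)
  moreover have "(\<lambda>m. pmf (poisson_pmf \<mu>) (Suc m) * (real (Suc m) * f (Suc m))) sums (\<mu> * I)"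
    unfolding shift using sums by (rule sums_mult)
  ultimately show ?thesis
    unfolding has_bochner_integral_pmf_nat_iff
    by (subst (asm) summable_Suc_iff, subst (asm) sums_Suc_iff) simp
qed

lemma
  assumes "\<mu> > 0"
  defines "P \<equiv> measure_pmf (poisson_pmf \<mu>)"
  shows poisson_moment_1: "has_bochner_integral P (\<lambda>m. real m) \<mu>"
    and poisson_centered_moment_1: "has_bochner_integral P (\<lambda>m. real m - \<mu>) 0"
    and poisson_centered_moment_2: "has_bochner_integral P (\<lambda>m. (real m - \<mu>)\<^sup>2) \<mu>"
    and poisson_centered_moment_4: "has_bochner_integral P (\<lambda>m. (real m - \<mu>) ^ 4) (\<mu> + 3 * \<mu>\<^sup>2)"
proof -
  note raise = has_bochner_integral_poisson_mult[OF assms(1), folded P_def]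
  note add = has_bochner_integral_add and scale = has_bochner_integral_mult_right
  have moment_0: "has_bochner_integral P (\<lambda>m. 1) (1::real)"
    unfolding P_def has_bochner_integral_iff by simp
  show moment_1: "has_bochner_integral P (\<lambda>m. real m) \<mu>"
    using raise[OF moment_0] by simp
  have moment_2: "has_bochner_integral P (\<lambda>m. real m ^ 2) (\<mu>\<^sup>2 + \<mu>)"
    using raise[of "\<lambda>m. real m", of "\<mu> + 1"] add[OF moment_1 moment_0]
    by (simp add: power2_eq_square algebra_simps)
  have moment_3: "has_bochner_integral P (\<lambda>m. real m ^ 3) (\<mu> ^ 3 + 3 * \<mu>\<^sup>2 + \<mu>)"
    using raise[of "\<lambda>m. real m ^ 2", of "(\<mu>\<^sup>2 + \<mu>) + 2 * \<mu> + 1"]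
      add[OF add[OF moment_2 scale[OF moment_1, of 2]] moment_0]
    by (simp add: eval_nat_numeral algebra_simps)
  have moment_4: "has_bochner_integral P (\<lambda>m. real m ^ 4) (\<mu> ^ 4 + 6 * \<mu> ^ 3 + 7 * \<mu>\<^sup>2 + \<mu>)"
    using raise[of "\<lambda>m. real m ^ 3", of "(\<mu> ^ 3 + 3 * \<mu>\<^sup>2 + \<mu>) + 3 * (\<mu>\<^sup>2 + \<mu>) + 3 * \<mu> + 1"]
      add[OF add[OF add[OF moment_3 scale[OF moment_2, of 3]] scale[OF moment_1, of 3]] moment_0]
    by (simp add: eval_nat_numeral algebra_simps)
  show "has_bochner_integral P (\<lambda>m. real m - \<mu>) 0"
    using add[OF moment_1 scale[OF moment_0, of "- \<mu>"]] by simp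
  show "has_bochner_integral P (\<lambda>m. (real m - \<mu>)\<^sup>2) \<mu>"
    using add[OF add[OF moment_2 scale[OF moment_1, of "- 2 * \<mu>"]] scale[OF moment_0, of "\<mu>\<^sup>2"]]
    by (simp add: eval_nat_numeral algebra_simps)
  show "has_bochner_integral P (\<lambda>m. (real m - \<mu>) ^ 4) (\<mu> + 3 * \<mu>\<^sup>2)"
    using add[OF add[OF add[OF add[OF moment_4
        scale[OF moment_3, of "- 4 * \<mu>"]] scale[OF moment_2, of "6 * \<mu>\<^sup>2"]]
        scale[OF moment_1, of "- 4 * \<mu> ^ 3"]] scale[OF moment_0, of "\<mu> ^ 4"]]
    by (simp add: eval_nat_numeral algebra_simps)
qed

section \<open>The experiment with observed jumps\<close>

definition normal_poisson :: "real \<Rightarrow> real \<Rightarrow> real \<Rightarrow> (real \<times> nat) measure" where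
  "normal_poisson \<delta> s \<nu> = density lborel (normal_density \<delta> s) \<Otimes>\<^sub>M measure_pmf (poisson_pmf \<nu>)"

definition normal_poisson_ratio :: "real \<Rightarrow> real \<Rightarrow> real \<Rightarrow> real \<Rightarrow> real \<times> nat \<Rightarrow> real" where
  "normal_poisson_ratio \<delta> s \<nu> \<mu> z = normal_density \<delta> s (fst z) / std_normal_density (fst z) *
    (pmf (poisson_pmf \<nu>) (snd z) / pmf (poisson_pmf \<mu>) (snd z))"

text \<open>The number \<open>x\<close> of jumps is real because it will be replaced by an estimate, which may be negative.\<close>

definition normal_poisson_score :: "real \<Rightarrow> real \<Rightarrow> real \<Rightarrow> real \<Rightarrow> real \<Rightarrow> real \<Rightarrow> real" where
  "normal_poisson_score \<alpha> \<beta> \<kappa> \<mu> g x = \<alpha> * g + \<beta> * (g\<^sup>2 - 1) + \<kappa> * (x - \<mu>)"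

lemma sets_normal_poisson [measurable_cong]: "sets (normal_poisson \<delta> s \<nu>) = sets (borel \<Otimes>\<^sub>M count_space UNIV)"
  unfolding normal_poisson_def by (intro sets_pair_measure_cong) auto

lemma prob_space_normal_poisson:
  assumes "s > 0"
  shows "prob_space (normal_poisson \<delta> s \<nu>)"
proof -
  interpret normal: prob_space "density lborel (normal_density \<delta> s)"
    by (rule prob_space_normal_density[OF assms])
  interpret pair_prob_space "density lborel (normal_density \<delta> s)" "measure_pmf (poisson_pmf \<nu>)" ..
  show ?thesis unfolding normal_poisson_def by unfold_locales
qed

lemma normal_poisson_ratio_measurable [measurable]:
  "normal_poisson_ratio \<delta> s \<nu> \<mu> \<in> borel_measurable (borel \<Otimes>\<^sub>M count_space UNIV)"
  unfolding normal_poisson_ratio_def by measurable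

lemma normal_poisson_ratio_nonneg: "normal_poisson_ratio \<delta> s \<nu> \<mu> z \<ge> 0"
  unfolding normal_poisson_ratio_def by simp

lemma normal_poisson_score_measurable [measurable]:
  "(\<lambda>z. normal_poisson_score \<alpha> \<beta> \<kappa> \<mu> (fst z) (real (snd z))) \<in> borel_measurable (borel \<Otimes>\<^sub>M count_space UNIV)"
  unfolding normal_poisson_score_def by measurable

lemma normal_poisson_eq_density:
  assumes \<mu>: "\<mu> > 0" and \<nu>: "\<nu> > 0" and s: "s > 0"
  shows "normal_poisson \<delta> s \<nu> = density (normal_poisson 0 1 \<mu>) (normal_poisson_ratio \<delta> s \<nu> \<mu>)"
proof -
  let ?normal_ratio = "\<lambda>g. normal_density \<delta> s g / std_normal_density g"
  let ?poisson_ratio = "\<lambda>m. pmf (poisson_pmf \<nu>) m / pmf (poisson_pmf \<mu>) m"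
  have "std_normal_density g * ?normal_ratio g = normal_density \<delta> s g" for g
    using normal_density_pos[of 1 0 g] by simp
  hence normal: "density std_normal_distribution ?normal_ratio = density lborel (normal_density \<delta> s)"
    by (subst density_density_eq) (simp_all add: ennreal_mult'[symmetric])
  have "pmf (poisson_pmf \<mu>) m * ?poisson_ratio m = pmf (poisson_pmf \<nu>) m" for m
    using \<mu> by simp
  hence poisson: "density (measure_pmf (poisson_pmf \<mu>)) ?poisson_ratio = measure_pmf (poisson_pmf \<nu>)"
    unfolding measure_pmf_eq_density by (subst density_density_eq) (simp_all add: ennreal_mult'[symmetric])
  have "normal_poisson \<delta> s \<nu> = density (normal_poisson 0 1 \<mu>)
      (\<lambda>(g, m). ennreal (?normal_ratio g) * ennreal (?poisson_ratio m))"
    unfolding normal_poisson_def normal[symmetric] poisson[symmetric]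
    by (rule pair_measure_density)
       (use measure_pmf.sigma_finite_measure_axioms in \<open>simp_all add: poisson\<close>)
  also have "(\<lambda>(g, m). ennreal (?normal_ratio g) * ennreal (?poisson_ratio m)) =
      (\<lambda>z. ennreal (normal_poisson_ratio \<delta> s \<nu> \<mu> z))"
    by (auto simp: normal_poisson_ratio_def ennreal_mult[symmetric] fun_eq_iff)
  finally show ?thesis .
qed

lemma has_bochner_integral_normal_poisson:
  assumes "s > 0" "has_bochner_integral (density lborel (normal_density \<delta> s)) f I"
    "has_bochner_integral (measure_pmf (poisson_pmf \<nu>)) k J"
  shows "has_bochner_integral (normal_poisson \<delta> s \<nu>) (\<lambda>z. f (fst z) * k (snd z)) (I * J :: real)"
  unfolding normal_poisson_def
  by (rule has_bochner_integral_pair_mult[OF _ _ assms(2,3)])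
     (intro prob_space_imp_sigma_finite prob_space_normal_density assms(1) measure_pmf.prob_space_axioms)+

lemma has_bochner_integral_normal_poisson_fst:
  assumes "s > 0" "has_bochner_integral (density lborel (normal_density \<delta> s)) f I"
  shows "has_bochner_integral (normal_poisson \<delta> s \<nu>) (\<lambda>z. f (fst z)) (I :: real)"
  using has_bochner_integral_normal_poisson[OF assms, of \<nu> "\<lambda>_. 1" 1]
  by (simp add: has_bochner_integral_iff)

lemma has_bochner_integral_normal_poisson_snd:
  assumes "s > 0" "has_bochner_integral (measure_pmf (poisson_pmf \<nu>)) k J"
  shows "has_bochner_integral (normal_poisson \<delta> s \<nu>) (\<lambda>z. k (snd z)) (J :: real)"
proof -
  interpret normal: prob_space "density lborel (normal_density \<delta> s)"
    by (rule prob_space_normal_density[OF assms(1)])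
  have "has_bochner_integral (density lborel (normal_density \<delta> s)) (\<lambda>_. 1) (1 :: real)"
    using normal.prob_space by (simp add: has_bochner_integral_iff)
  from has_bochner_integral_normal_poisson[OF assms(1) this assms(2)] show ?thesis by simp
qed

lemma normal_poisson_score_mean:
  assumes s: "s > 0" and \<nu>: "\<nu> > 0"
  shows "has_bochner_integral (normal_poisson \<delta> s \<nu>)
    (\<lambda>z. normal_poisson_score \<alpha> \<beta> \<kappa> \<mu> (fst z) (real (snd z))) (\<alpha> * \<delta> + \<beta> * (s\<^sup>2 + \<delta>\<^sup>2 - 1) + \<kappa> * (\<nu> - \<mu>))"
proof -
  interpret prob_space "normal_poisson \<delta> s \<nu>" by (rule prob_space_normal_poisson[OF s])
  note add = has_bochner_integral_add and sub = has_bochner_integral_diff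
    and scale = has_bochner_integral_mult_right
  note normal = has_bochner_integral_normal_poisson_fst[OF s]
    and poisson = has_bochner_integral_normal_poisson_snd[OF s]
  have constant_mean: "has_bochner_integral (normal_poisson \<delta> s \<nu>) (\<lambda>_. c) c" for c :: real
    by (simp add: has_bochner_integral_iff prob_space)
  show ?thesis
    unfolding normal_poisson_score_def
    by (intro add sub scale constant_mean normal[OF normal_moment_1[OF s]] normal[OF normal_moment_2[OF s]]
        poisson[OF poisson_moment_1[OF \<nu>]])
qed

lemma
  shows std_normal_score_mean: "has_bochner_integral std_normal_distribution (\<lambda>g. \<alpha> * g + \<beta> * (g\<^sup>2 - 1)) 0"
    and std_normal_score_second_moment:
      "has_bochner_integral std_normal_distribution (\<lambda>g. (\<alpha> * g + \<beta> * (g\<^sup>2 - 1))\<^sup>2) (\<alpha>\<^sup>2 + 2 * \<beta>\<^sup>2)"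
    and std_normal_hermite_fourth_moment:
      "has_bochner_integral std_normal_distribution (\<lambda>g. (g\<^sup>2 - 1) ^ 4) 60"
proof -
  interpret normal: prob_space std_normal_distribution by (rule prob_space_normal_density) simp
  note add = has_bochner_integral_add and scale = has_bochner_integral_mult_right
  have mass: "has_bochner_integral std_normal_distribution (\<lambda>_. 1) (1 :: real)"
    using normal.prob_space by (simp add: has_bochner_integral_iff)
  note moments = std_normal_moments mass
  have "has_bochner_integral std_normal_distribution
      (\<lambda>g. \<alpha> * g + (\<beta> * g\<^sup>2 + (- \<beta>) * 1)) (\<alpha> * 0 + (\<beta> * 1 + (- \<beta>) * 1))"
    by (intro add scale moments)
  thus "has_bochner_integral std_normal_distribution (\<lambda>g. \<alpha> * g + \<beta> * (g\<^sup>2 - 1)) 0"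
    by (simp add: algebra_simps)
  have "has_bochner_integral std_normal_distribution
      (\<lambda>g. \<beta>\<^sup>2 * g ^ 4 + (2 * \<alpha> * \<beta> * g ^ 3 + ((\<alpha>\<^sup>2 - 2 * \<beta>\<^sup>2) * g\<^sup>2 + ((- 2 * \<alpha> * \<beta>) * g + \<beta>\<^sup>2 * 1))))
      (\<beta>\<^sup>2 * 3 + (2 * \<alpha> * \<beta> * 0 + ((\<alpha>\<^sup>2 - 2 * \<beta>\<^sup>2) * 1 + ((- 2 * \<alpha> * \<beta>) * 0 + \<beta>\<^sup>2 * 1))))"
    by (intro add scale moments)
  thus "has_bochner_integral std_normal_distribution (\<lambda>g. (\<alpha> * g + \<beta> * (g\<^sup>2 - 1))\<^sup>2) (\<alpha>\<^sup>2 + 2 * \<beta>\<^sup>2)"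
    by (simp add: eval_nat_numeral algebra_simps)
  have "has_bochner_integral std_normal_distribution
      (\<lambda>g. g ^ 8 + ((- 4) * g ^ 6 + (6 * g ^ 4 + ((- 4) * g\<^sup>2 + 1))))
      (105 + ((- 4) * 15 + (6 * 3 + ((- 4) * 1 + 1))))"
    by (intro add scale moments)
  thus "has_bochner_integral std_normal_distribution (\<lambda>g. (g\<^sup>2 - 1) ^ 4) 60"
    by (simp add: eval_nat_numeral algebra_simps)
qed

lemma normal_poisson_score_second_moment:
  assumes \<mu>: "\<mu> > 0"
  shows "has_bochner_integral (normal_poisson 0 1 \<mu>)
    (\<lambda>z. (normal_poisson_score \<alpha> \<beta> \<kappa> \<mu> (fst z) (real (snd z)))\<^sup>2) (\<alpha>\<^sup>2 + 2 * \<beta>\<^sup>2 + \<kappa>\<^sup>2 * \<mu>)"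
proof -
  let ?normal_score = "\<lambda>g. \<alpha> * g + \<beta> * (g\<^sup>2 - 1)"
  have "has_bochner_integral (normal_poisson 0 1 \<mu>)
    (\<lambda>z. (?normal_score (fst z))\<^sup>2 +
       (2 * \<kappa> * (?normal_score (fst z) * (real (snd z) - \<mu>)) + \<kappa>\<^sup>2 * (real (snd z) - \<mu>)\<^sup>2))
    ((\<alpha>\<^sup>2 + 2 * \<beta>\<^sup>2) + (2 * \<kappa> * (0 * 0) + \<kappa>\<^sup>2 * \<mu>))"
    by (intro has_bochner_integral_add has_bochner_integral_mult_right
        has_bochner_integral_normal_poisson_fst std_normal_score_second_moment
        has_bochner_integral_normal_poisson_snd poisson_centered_moment_2[OF \<mu>]
        has_bochner_integral_normal_poisson std_normal_score_mean poisson_centered_moment_1[OF \<mu>]) simp_all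
  thus ?thesis
    by (simp add: normal_poisson_score_def power2_eq_square algebra_simps)
qed

lemma power2_sum3_le: "(x + y + z)\<^sup>2 \<le> 3 * (x\<^sup>2 + y\<^sup>2 + z\<^sup>2)" for x y z :: real
  using zero_le_power2[of "x - y"] zero_le_power2[of "y - z"] zero_le_power2[of "x - z"]
  by (simp add: power2_eq_square algebra_simps)

lemma power4_sum3_le: "(x + y + z) ^ 4 \<le> 27 * (x ^ 4 + y ^ 4 + z ^ 4)" for x y z :: real
proof -
  have "((x + y + z)\<^sup>2)\<^sup>2 \<le> (3 * (x\<^sup>2 + y\<^sup>2 + z\<^sup>2))\<^sup>2"
    by (rule power_mono[OF power2_sum3_le]) simp
  also have "\<dots> \<le> 9 * (3 * ((x\<^sup>2)\<^sup>2 + (y\<^sup>2)\<^sup>2 + (z\<^sup>2)\<^sup>2))"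
    unfolding power_mult_distrib using power2_sum3_le[of "x\<^sup>2" "y\<^sup>2" "z\<^sup>2"] by simp
  finally show ?thesis by simp
qed

lemma normal_poisson_score_fourth_moment:
  assumes \<mu>: "\<mu> > 0"
  shows "integrable (normal_poisson 0 1 \<mu>) (\<lambda>z. normal_poisson_score \<alpha> \<beta> \<kappa> \<mu> (fst z) (real (snd z)) ^ 4)"
    and "(LINT z|normal_poisson 0 1 \<mu>. normal_poisson_score \<alpha> \<beta> \<kappa> \<mu> (fst z) (real (snd z)) ^ 4)
      \<le> 27 * (3 * \<alpha> ^ 4 + 60 * \<beta> ^ 4 + \<kappa> ^ 4 * (\<mu> + 3 * \<mu>\<^sup>2))"
proof -
  let ?P = "normal_poisson 0 1 \<mu>"
  let ?S = "\<lambda>z. normal_poisson_score \<alpha> \<beta> \<kappa> \<mu> (fst z) (real (snd z))"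
  let ?bound = "\<lambda>z. 27 * (\<alpha> ^ 4 * fst z ^ 4 + \<beta> ^ 4 * ((fst z)\<^sup>2 - 1) ^ 4 + \<kappa> ^ 4 * (real (snd z) - \<mu>) ^ 4)"
  have bound: "has_bochner_integral ?P ?bound (27 * (\<alpha> ^ 4 * 3 + \<beta> ^ 4 * 60 + \<kappa> ^ 4 * (\<mu> + 3 * \<mu>\<^sup>2)))"
    by (intro has_bochner_integral_add has_bochner_integral_mult_right
        has_bochner_integral_normal_poisson_fst std_normal_moment_4 std_normal_hermite_fourth_moment
        has_bochner_integral_normal_poisson_snd poisson_centered_moment_4[OF \<mu>]) simp_all
  have pointwise_le: "?S z ^ 4 \<le> ?bound z" for z
    using power4_sum3_le[of "\<alpha> * fst z" "\<beta> * ((fst z)\<^sup>2 - 1)" "\<kappa> * (real (snd z) - \<mu>)"]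
    by (simp add: normal_poisson_score_def power_mult_distrib)
  show fourth_integrable: "integrable ?P (\<lambda>z. ?S z ^ 4)"
  proof (rule Bochner_Integration.integrable_bound)
    show "integrable ?P ?bound" using bound by (simp add: has_bochner_integral_iff)
    show "AE z in ?P. norm (?S z ^ 4) \<le> norm (?bound z)"
      using pointwise_le by (intro AE_I2) (simp add: abs_of_nonneg)
  qed measurable
  have "(LINT z|?P. ?S z ^ 4) \<le> integral\<^sup>L ?P ?bound"
    using bound fourth_integrable pointwise_le by (intro integral_mono) (auto simp: has_bochner_integral_iff)
  also have "\<dots> = 27 * (3 * \<alpha> ^ 4 + 60 * \<beta> ^ 4 + \<kappa> ^ 4 * (\<mu> + 3 * \<mu>\<^sup>2))"
    using bound by (simp add: has_bochner_integral_iff mult.commute)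
  finally show "(LINT z|?P. ?S z ^ 4) \<le> 27 * (3 * \<alpha> ^ 4 + 60 * \<beta> ^ 4 + \<kappa> ^ 4 * (\<mu> + 3 * \<mu>\<^sup>2))" .
qed

lemma has_bochner_integral_normal_poisson_ratio_mult:
  assumes "\<mu> > 0" "\<nu> > 0" "s > 0" "f \<in> borel_measurable (borel \<Otimes>\<^sub>M count_space UNIV)"
    and "has_bochner_integral (normal_poisson \<delta> s \<nu>) f I"
  shows "has_bochner_integral (normal_poisson 0 1 \<mu>) (\<lambda>z. normal_poisson_ratio \<delta> s \<nu> \<mu> z * f z) I"
proof -
  note [measurable] = assms(4)
  show ?thesis
    using assms(5) unfolding normal_poisson_eq_density[OF assms(1-3), of \<delta>]
    by (subst (asm) has_bochner_integral_density_iff) (simp_all add: normal_poisson_ratio_nonneg)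
qed

lemma normal_poisson_ratio_mean:
  assumes "\<mu> > 0" "\<nu> > 0" "s > 0"
  shows "has_bochner_integral (normal_poisson 0 1 \<mu>) (normal_poisson_ratio \<delta> s \<nu> \<mu>) 1"
proof -
  interpret prob_space "normal_poisson \<delta> s \<nu>" by (rule prob_space_normal_poisson[OF assms(3)])
  have "has_bochner_integral (normal_poisson \<delta> s \<nu>) (\<lambda>_. 1) (1 :: real)"
    by (simp add: has_bochner_integral_iff prob_space)
  from has_bochner_integral_normal_poisson_ratio_mult[OF assms _ this] show ?thesis by simp
qed

lemma normal_poisson_ratio_second_moment:
  assumes "\<mu> > 0" "\<nu> > 0" "s > 0" "s\<^sup>2 < 2"
  shows "has_bochner_integral (normal_poisson 0 1 \<mu>) (\<lambda>z. (normal_poisson_ratio \<delta> s \<nu> \<mu> z)\<^sup>2)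
    (exp (\<delta>\<^sup>2 / (2 - s\<^sup>2)) / (s * sqrt (2 - s\<^sup>2)) * exp ((\<nu> - \<mu>)\<^sup>2 / \<mu>))"
proof -
  have "has_bochner_integral (normal_poisson \<delta> s \<nu>) (normal_poisson_ratio \<delta> s \<nu> \<mu>)
    (exp (\<delta>\<^sup>2 / (2 - s\<^sup>2)) / (s * sqrt (2 - s\<^sup>2)) * exp ((\<nu> - \<mu>)\<^sup>2 / \<mu>))"
    using has_bochner_integral_normal_poisson[OF assms(3)
        normal_ratio_moment[OF assms(3,4)] poisson_ratio_moment[OF assms(1,2)]]
    unfolding normal_poisson_ratio_def[abs_def] .
  from has_bochner_integral_normal_poisson_ratio_mult[OF assms(1-3) _ this] show ?thesis
    by (simp add: power2_eq_square)
qed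

lemma normal_poisson_ratio_remainder_moment:
  assumes "\<mu> > 0" "\<nu> > 0" "s > 0" "s\<^sup>2 < 2"
  shows "has_bochner_integral (normal_poisson 0 1 \<mu>)
    (\<lambda>z. (normal_poisson_ratio \<delta> s \<nu> \<mu> z - (1 + normal_poisson_score \<alpha> \<beta> \<kappa> \<mu> (fst z) (real (snd z))))\<^sup>2)
    (exp (\<delta>\<^sup>2 / (2 - s\<^sup>2)) / (s * sqrt (2 - s\<^sup>2)) * exp ((\<nu> - \<mu>)\<^sup>2 / \<mu>) - 1
      + (\<alpha>\<^sup>2 + 2 * \<beta>\<^sup>2 + \<kappa>\<^sup>2 * \<mu>) - 2 * (\<alpha> * \<delta> + \<beta> * (s\<^sup>2 + \<delta>\<^sup>2 - 1) + \<kappa> * (\<nu> - \<mu>)))"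
proof -
  let ?P = "normal_poisson 0 1 \<mu>" and ?R = "normal_poisson_ratio \<delta> s \<nu> \<mu>"
  let ?S = "\<lambda>z. normal_poisson_score \<alpha> \<beta> \<kappa> \<mu> (fst z) (real (snd z))"
  interpret prob_space ?P by (rule prob_space_normal_poisson) simp
  note add = has_bochner_integral_add and scale = has_bochner_integral_mult_right
  have mass: "has_bochner_integral ?P (\<lambda>_. 1) (1 :: real)"
    by (simp add: has_bochner_integral_iff prob_space)
  have S_mean: "has_bochner_integral ?P ?S 0"
    using normal_poisson_score_mean[of 1 \<mu> 0 \<alpha> \<beta> \<kappa> \<mu>] assms(1) by simp
  have RS_mean: "has_bochner_integral ?P (\<lambda>z. ?R z * ?S z) (\<alpha> * \<delta> + \<beta> * (s\<^sup>2 + \<delta>\<^sup>2 - 1) + \<kappa> * (\<nu> - \<mu>))"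
    by (rule has_bochner_integral_normal_poisson_ratio_mult[OF assms(1-3) _
        normal_poisson_score_mean[OF assms(3,2)]]) measurable
  have "has_bochner_integral ?P
      (\<lambda>z. (?R z)\<^sup>2 + (1 + ((?S z)\<^sup>2 + ((- 2) * ?R z + (2 * ?S z + (- 2) * (?R z * ?S z))))))
      (exp (\<delta>\<^sup>2 / (2 - s\<^sup>2)) / (s * sqrt (2 - s\<^sup>2)) * exp ((\<nu> - \<mu>)\<^sup>2 / \<mu>) + (1 + ((\<alpha>\<^sup>2 + 2 * \<beta>\<^sup>2 + \<kappa>\<^sup>2 * \<mu>)
        + ((- 2) * 1 + (2 * 0 + (- 2) * (\<alpha> * \<delta> + \<beta> * (s\<^sup>2 + \<delta>\<^sup>2 - 1) + \<kappa> * (\<nu> - \<mu>)))))))"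
    by (intro add scale mass S_mean RS_mean normal_poisson_ratio_second_moment[OF assms]
        normal_poisson_score_second_moment[OF assms(1)] normal_poisson_ratio_mean[OF assms(1-3)])
  also have "(\<lambda>z. (?R z)\<^sup>2 + (1 + ((?S z)\<^sup>2 + ((- 2) * ?R z + (2 * ?S z + (- 2) * (?R z * ?S z)))))) =
      (\<lambda>z. (?R z - (1 + ?S z))\<^sup>2)"
    by (simp add: power2_eq_square algebra_simps)
  finally show ?thesis by (simp add: algebra_simps)
qed

section \<open>The observed increment\<close>

definition jump_increment :: "real \<Rightarrow> real \<Rightarrow> real \<times> nat \<Rightarrow> real" where
  "jump_increment d \<tau> z = d + \<tau> * fst z + real (snd z)"

definition increment_density :: "real \<Rightarrow> real \<Rightarrow> real \<Rightarrow> real \<Rightarrow> real" where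
  "increment_density d \<tau> \<nu> y = (\<Sum>m. pmf (poisson_pmf \<nu>) m * normal_density (d + real m) \<tau> y)"

lemma jump_increment_measurable [measurable]:
  "jump_increment d \<tau> \<in> borel_measurable (borel \<Otimes>\<^sub>M count_space UNIV)"
  unfolding jump_increment_def by measurable

lemma increment_density_measurable [measurable]: "increment_density d \<tau> \<nu> \<in> borel_measurable borel"
  unfolding increment_density_def by measurable

lemma summable_increment_density: "summable (\<lambda>m. pmf (poisson_pmf \<nu>) m * normal_density (d + real m) \<tau> y)"
proof -
  have "normal_density (d + real m) \<tau> y \<le> 1 / sqrt (2 * pi * \<tau>\<^sup>2)" for m
    unfolding normal_density_def by (rule mult_left_le) simp_all
  hence "integrable (measure_pmf (poisson_pmf \<nu>)) (\<lambda>m. normal_density (d + real m) \<tau> y)"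
    by (intro measure_pmf.integrable_const_bound[where B="1 / sqrt (2 * pi * \<tau>\<^sup>2)"]) simp_all
  from has_bochner_integral_integrable[OF this] show ?thesis
    unfolding has_bochner_integral_pmf_nat_iff using sums_summable by (elim conjE)
qed

lemma increment_density_pos:
  assumes "\<tau> > 0" "\<nu> > 0"
  shows "increment_density d \<tau> \<nu> y > 0"
  unfolding increment_density_def
  by (intro suminf_pos summable_increment_density mult_pos_pos normal_density_pos assms) (simp add: assms)

lemma distr_jump_increment:
  assumes s: "s > 0" and \<tau>: "\<tau> > 0"
  shows "distr (normal_poisson \<delta> s \<nu>) borel (jump_increment d \<tau>) =
    density lborel (increment_density (d + \<tau> * \<delta>) (\<tau> * s) \<nu>)"
proof (rule measure_eqI)
  fix A assume "A \<in> sets (distr (normal_poisson \<delta> s \<nu>) borel (jump_increment d \<tau>))"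
  hence [measurable]: "A \<in> sets borel" by simp
  let ?N = "density lborel (normal_density \<delta> s)" and ?p = "poisson_pmf \<nu>"
  let ?f = "\<lambda>m. normal_density (d + \<tau> * \<delta> + real m) (\<tau> * s)"
  interpret normal: prob_space ?N by (rule prob_space_normal_density[OF s])
  interpret pair_prob_space ?N "measure_pmf ?p" ..
  have component: "(\<integral>\<^sup>+g. indicator A (d + \<tau> * g + real m) \<partial>?N) =
      (\<integral>\<^sup>+y. ennreal (?f m y) * indicator A y \<partial>lborel)" for m
  proof -
    have "(\<integral>\<^sup>+g. indicator A (d + \<tau> * g + real m) \<partial>?N) =
        (\<integral>\<^sup>+y. indicator A y \<partial>distr ?N borel (\<lambda>g. (d + real m) + \<tau> * g))"
      by (subst nn_integral_distr) (auto simp: ac_simps)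
    also have "\<dots> = (\<integral>\<^sup>+y. ennreal (?f m y) * indicator A y \<partial>lborel)"
      unfolding distr_normal_affine[OF s \<tau>] by (subst nn_integral_density) (auto simp: ac_simps)
    finally show ?thesis .
  qed
  have "emeasure (distr (normal_poisson \<delta> s \<nu>) borel (jump_increment d \<tau>)) A =
      (\<integral>\<^sup>+z. indicator A (d + \<tau> * fst z + real (snd z)) \<partial>normal_poisson \<delta> s \<nu>)"
    by (subst nn_integral_indicator[symmetric])
       (auto simp: nn_integral_distr jump_increment_def simp del: nn_integral_indicator)
  also have "\<dots> = (\<integral>\<^sup>+m. \<integral>\<^sup>+g. indicator A (d + \<tau> * g + real m) \<partial>?N \<partial>?p)"
    unfolding normal_poisson_def by (subst nn_integral_snd[symmetric]) auto
  also have "\<dots> = (\<Sum>m. \<integral>\<^sup>+y. ennreal (pmf ?p m * ?f m y) * indicator A y \<partial>lborel)"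
    unfolding component nn_integral_measure_pmf nn_integral_count_space_nat
    by (simp add: nn_integral_cmult[symmetric] ennreal_mult mult.assoc)
  also have "\<dots> = (\<integral>\<^sup>+y. (\<Sum>m. ennreal (pmf ?p m * ?f m y)) * indicator A y \<partial>lborel)"
    by (subst nn_integral_suminf[symmetric]) auto
  also have "\<dots> = (\<integral>\<^sup>+y. ennreal (increment_density (d + \<tau> * \<delta>) (\<tau> * s) \<nu> y) * indicator A y \<partial>lborel)"
    unfolding increment_density_def by (simp add: suminf_ennreal2 summable_increment_density)
  also have "\<dots> = emeasure (density lborel (increment_density (d + \<tau> * \<delta>) (\<tau> * s) \<nu>)) A"
    by (subst emeasure_density) auto
  finally show "emeasure (distr (normal_poisson \<delta> s \<nu>) borel (jump_increment d \<tau>)) A =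
    emeasure (density lborel (increment_density (d + \<tau> * \<delta>) (\<tau> * s) \<nu>)) A" .
qed simp

lemma image_density_jump_increment:
  assumes \<mu>: "\<mu> > 0" and \<nu>: "\<nu> > 0" and s: "s > 0" and \<tau>: "\<tau> > 0"
  shows "image_density (normal_poisson 0 1 \<mu>) borel (jump_increment d \<tau>) (normal_poisson_ratio \<delta> s \<nu> \<mu>)
    (\<lambda>y. increment_density (d + \<tau> * \<delta>) (\<tau> * s) \<nu> y / increment_density d \<tau> \<mu> y)"
proof -
  let ?P = "normal_poisson 0 1 \<mu>" and ?T = "jump_increment d \<tau>"
  let ?alt = "increment_density (d + \<tau> * \<delta>) (\<tau> * s) \<nu>" and ?null = "increment_density d \<tau> \<mu>"
  interpret prob_space ?P by (rule prob_space_normal_poisson) simp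
  have pos: "?alt y > 0" "?null y > 0" for y
    using increment_density_pos assms by simp_all
  show ?thesis
  proof unfold_locales
    show "integrable ?P (normal_poisson_ratio \<delta> s \<nu> \<mu>)"
      using normal_poisson_ratio_mean[OF \<mu> \<nu> s] by (auto simp: has_bochner_integral_iff)
    have "ennreal (?null y) * ennreal (?alt y / ?null y) = ennreal (?alt y)" for y
      using pos[of y] by (simp add: ennreal_mult[symmetric] less_imp_le)
    hence "density (density lborel ?null) (\<lambda>y. ?alt y / ?null y) = density lborel ?alt"
      by (subst density_density_eq) simp_all
    moreover have "distr ?P borel ?T = density lborel ?null"
      using distr_jump_increment[of 1 \<tau> 0] \<tau> by simp
    ultimately show "distr (density ?P (normal_poisson_ratio \<delta> s \<nu> \<mu>)) borel ?T =
        density (distr ?P borel ?T) (\<lambda>y. ?alt y / ?null y)"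
      using distr_jump_increment[OF s \<tau>] unfolding normal_poisson_eq_density[OF \<mu> \<nu> s, symmetric] by simp
  qed (use pos in \<open>simp_all add: normal_poisson_ratio_nonneg less_imp_le\<close>)
qed

definition rounded_score :: "real \<Rightarrow> real \<Rightarrow> real \<Rightarrow> real \<Rightarrow> real \<Rightarrow> real \<Rightarrow> real \<Rightarrow> real" where
  "rounded_score \<alpha> \<beta> \<kappa> \<mu> d \<tau> y =
    normal_poisson_score \<alpha> \<beta> \<kappa> \<mu> ((y - d - of_int (round (y - d))) / \<tau>) (of_int (round (y - d)))"

lemma rounded_score_measurable [measurable]: "rounded_score \<alpha> \<beta> \<kappa> \<mu> d \<tau> \<in> borel_measurable borel"
  unfolding rounded_score_def normal_poisson_score_def round_def by measurable

lemma abs_round_le_square: "\<bar>of_int (round x)\<bar> \<le> 4 * x\<^sup>2" for x :: real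
proof (cases "round x = 0")
  case False
  hence "\<bar>of_int (round x) :: real\<bar> \<ge> 1" by linarith
  with of_int_round_abs_le[of x] have x: "1 \<le> 2 * \<bar>x\<bar>" "\<bar>of_int (round x)\<bar> \<le> 2 * \<bar>x\<bar>" by linarith+
  note x(2)
  also have "2 * \<bar>x\<bar> * 1 \<le> 2 * \<bar>x\<bar> * (2 * \<bar>x\<bar>)"
    by (rule mult_left_mono[OF x(1)]) simp
  finally show ?thesis by (simp add: power2_eq_square)
qed simp

text \<open>
  Rounding recovers \<open>m\<close> unless \<open>\<bar>\<tau> g\<bar> \<ge> 1/2\<close>; the bound \<open>\<bar>round x\<bar> \<le> 4 x\<^sup>2\<close> turns the rarity of this event
  into the factor \<open>\<tau>\<^sup>2\<close> without distinguishing cases.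
\<close>

lemma rounded_score_error:
  assumes \<tau>: "\<tau> > 0"
  shows "(normal_poisson_score \<alpha> \<beta> \<kappa> \<mu> g (real m) - rounded_score \<alpha> \<beta> \<kappa> \<mu> d \<tau> (d + \<tau> * g + real m))\<^sup>2
    \<le> 48 * \<tau>\<^sup>2 * ((\<alpha>\<^sup>2 + (\<kappa> * \<tau>)\<^sup>2) * g ^ 4 + 4 * \<beta>\<^sup>2 * g ^ 6)"
proof -
  define j where "j = (of_int (round (\<tau> * g)) :: real)"
  define h where "h = g - j / \<tau>"
  define e where "e = normal_poisson_score \<alpha> \<beta> \<kappa> \<mu> g (real m) -
    rounded_score \<alpha> \<beta> \<kappa> \<mu> d \<tau> (d + \<tau> * g + real m)"
  have "round (\<tau> * g + real m) = round (\<tau> * g) + int m"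
    using floor_add_int[of "\<tau> * g + 1 / 2" "int m"] by (simp add: round_def ac_simps)
  hence e: "e = j / \<tau> * (\<alpha> + \<beta> * (g + h) - \<kappa> * \<tau>)"
    using \<tau> unfolding e_def h_def rounded_score_def normal_poisson_score_def j_def
    by (simp add: field_simps power2_eq_square)
  have "\<bar>j\<bar> \<le> 4 * (\<tau> * g)\<^sup>2"
    unfolding j_def by (rule abs_round_le_square)
  hence j_le: "\<bar>j / \<tau>\<bar> \<le> 4 * \<tau> * g\<^sup>2"
    using \<tau> by (simp add: field_simps power2_eq_square)
  have "\<bar>\<tau> * g - j\<bar> \<le> \<tau> * \<bar>g\<bar>"
    using round_diff_minimal[of "\<tau> * g" 0] \<tau> by (simp add: j_def abs_mult)
  moreover have "\<tau> * g - j = \<tau> * h"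
    using \<tau> by (simp add: h_def algebra_simps)
  hence "\<bar>\<tau> * g - j\<bar> = \<tau> * \<bar>h\<bar>"
    using \<tau> by (simp add: abs_mult)
  ultimately have "\<bar>g + h\<bar> \<le> 2 * \<bar>g\<bar>"
    using \<tau> abs_triangle_ineq[of g h] by simp
  hence "\<bar>\<beta>\<bar> * \<bar>g + h\<bar> \<le> \<bar>\<beta>\<bar> * (2 * \<bar>g\<bar>)"
    by (rule mult_left_mono) simp
  hence "\<bar>\<alpha> + \<beta> * (g + h) - \<kappa> * \<tau>\<bar> \<le> \<bar>\<alpha>\<bar> + \<bar>\<kappa> * \<tau>\<bar> + 2 * \<bar>\<beta>\<bar> * \<bar>g\<bar>"
    unfolding abs_mult[symmetric] by linarith
  hence "\<bar>e\<bar> \<le> 4 * \<tau> * g\<^sup>2 * (\<bar>\<alpha>\<bar> + \<bar>\<kappa> * \<tau>\<bar> + 2 * \<bar>\<beta>\<bar> * \<bar>g\<bar>)"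
    unfolding e abs_mult[of "j / \<tau>"] using j_le \<tau> by (intro mult_mono) auto
  hence "\<bar>e\<bar>\<^sup>2 \<le> (4 * \<tau> * g\<^sup>2 * (\<bar>\<alpha>\<bar> + \<bar>\<kappa> * \<tau>\<bar> + 2 * \<bar>\<beta>\<bar> * \<bar>g\<bar>))\<^sup>2"
    by (intro power_mono) auto
  also have "\<dots> = (4 * \<tau> * g\<^sup>2)\<^sup>2 * (\<bar>\<alpha>\<bar> + \<bar>\<kappa> * \<tau>\<bar> + 2 * \<bar>\<beta>\<bar> * \<bar>g\<bar>)\<^sup>2"
    by (rule power_mult_distrib)
  also have "\<dots> \<le> (4 * \<tau> * g\<^sup>2)\<^sup>2 * (3 * (\<bar>\<alpha>\<bar>\<^sup>2 + \<bar>\<kappa> * \<tau>\<bar>\<^sup>2 + (2 * \<bar>\<beta>\<bar> * \<bar>g\<bar>)\<^sup>2))"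
    by (intro mult_left_mono power2_sum3_le) simp
  also have "\<dots> = 48 * \<tau>\<^sup>2 * ((\<alpha>\<^sup>2 + (\<kappa> * \<tau>)\<^sup>2) * g ^ 4 + 4 * \<beta>\<^sup>2 * g ^ 6)"
    by (simp only: power_mult_distrib power2_abs) (simp add: eval_nat_numeral algebra_simps)
  finally show ?thesis by (simp only: power2_abs e_def)
qed

lemma rounded_score_error_moment:
  fixes \<alpha> \<beta> \<kappa> \<mu> d \<tau> :: real
  assumes \<tau>: "\<tau> > 0"
  defines "E \<equiv> \<lambda>z. (normal_poisson_score \<alpha> \<beta> \<kappa> \<mu> (fst z) (real (snd z)) -
    rounded_score \<alpha> \<beta> \<kappa> \<mu> d \<tau> (jump_increment d \<tau> z))\<^sup>2"
  shows "integrable (normal_poisson 0 1 \<mu>) E"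
    and "(LINT z|normal_poisson 0 1 \<mu>. E z) \<le> 48 * \<tau>\<^sup>2 * (3 * (\<alpha>\<^sup>2 + (\<kappa> * \<tau>)\<^sup>2) + 60 * \<beta>\<^sup>2)"
proof -
  let ?P = "normal_poisson 0 1 \<mu>"
  let ?bound = "\<lambda>z::real \<times> nat. 48 * \<tau>\<^sup>2 * ((\<alpha>\<^sup>2 + (\<kappa> * \<tau>)\<^sup>2) * fst z ^ 4 + 4 * \<beta>\<^sup>2 * fst z ^ 6)"
  have bound: "has_bochner_integral ?P ?bound (48 * \<tau>\<^sup>2 * ((\<alpha>\<^sup>2 + (\<kappa> * \<tau>)\<^sup>2) * 3 + 4 * \<beta>\<^sup>2 * 15))"
    by (intro has_bochner_integral_add has_bochner_integral_mult_right
        has_bochner_integral_normal_poisson_fst std_normal_moment_4 std_normal_moment_6) simp_all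
  have pointwise_le: "E z \<le> ?bound z" for z
    unfolding E_def jump_increment_def by (rule rounded_score_error[OF \<tau>])
  show E_integrable: "integrable ?P E"
  proof (rule Bochner_Integration.integrable_bound)
    show "integrable ?P ?bound" using bound by (simp add: has_bochner_integral_iff)
    show "E \<in> borel_measurable ?P" unfolding E_def by measurable
    show "AE z in ?P. norm (E z) \<le> norm (?bound z)"
      using pointwise_le by (intro AE_I2) (simp add: E_def abs_of_nonneg)
  qed
  have "integral\<^sup>L ?P E \<le> integral\<^sup>L ?P ?bound"
    using bound E_integrable pointwise_le by (intro integral_mono) (auto simp: has_bochner_integral_iff)
  also have "\<dots> = 48 * \<tau>\<^sup>2 * (3 * (\<alpha>\<^sup>2 + (\<kappa> * \<tau>)\<^sup>2) + 60 * \<beta>\<^sup>2)"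
    using bound by (simp add: has_bochner_integral_iff algebra_simps)
  finally show "integral\<^sup>L ?P E \<le> 48 * \<tau>\<^sup>2 * (3 * (\<alpha>\<^sup>2 + (\<kappa> * \<tau>)\<^sup>2) + 60 * \<beta>\<^sup>2)" .
qed

section \<open>Asymptotics of one increment\<close>

lemma tendsto_0_of_scaled:
  fixes c x :: "'a \<Rightarrow> real"
  assumes c: "filterlim c at_top F" and scaled: "((\<lambda>n. c n * x n) \<longlongrightarrow> L) F"
  shows "(x \<longlongrightarrow> 0) F"
proof -
  have "((\<lambda>n. (c n * x n) / c n) \<longlongrightarrow> 0) F"
    by (rule real_tendsto_divide_at_top[OF scaled c])
  thus ?thesis
    by (rule Lim_transform_eventually)
       (use filterlim_at_top_dense[THEN iffD1, OF c, rule_format, of 0] in eventually_elim, simp)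
qed

lemma filterlim_sqrt_real_at_top: "filterlim (\<lambda>n. sqrt (real n)) at_top sequentially"
  by (rule filterlim_compose[OF sqrt_at_top filterlim_real_sequentially])

text \<open>
  The null hypothesis \<open>(d, \<tau>, \<mu>)\<close> and the alternative \<open>(d', \<tau>', \<nu>)\<close> consist of the mean and the
  standard deviation of the Gaussian part of an increment, and of its mean number of jumps.
\<close>

locale local_alternatives =
  fixes d \<tau> \<mu> d' \<tau>' \<nu> :: "nat \<Rightarrow> real" and a b k :: real
  assumes \<tau>_pos: "\<And>n. \<tau> n > 0" and \<mu>_pos: "\<And>n. \<mu> n > 0"
    and eventually_\<nu>_pos: "\<forall>\<^sub>F n in sequentially. \<nu> n > 0"
    and mean_rate: "(\<lambda>n. sqrt (real n) * ((d' n - d n) / \<tau> n)) \<longlonglongrightarrow> a"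
    and scale_rate: "(\<lambda>n. sqrt (real n) * (\<tau>' n / \<tau> n - 1)) \<longlonglongrightarrow> b"
    and intensity_rate: "(\<lambda>n. real n * ((\<nu> n - \<mu> n)\<^sup>2 / \<mu> n)) \<longlonglongrightarrow> k"
    and n\<mu>_at_top: "filterlim (\<lambda>n. real n * \<mu> n) at_top sequentially"
    and \<tau>_tendsto_0: "\<tau> \<longlonglongrightarrow> 0" and \<tau>_\<mu>_bounded: "Bseq (\<lambda>n. (\<tau> n)\<^sup>2 / \<mu> n)"
begin

definition \<delta> :: "nat \<Rightarrow> real" where "\<delta> n = (d' n - d n) / \<tau> n"
definition s :: "nat \<Rightarrow> real" where "s n = \<tau>' n / \<tau> n"
definition \<kappa> :: "nat \<Rightarrow> real" where "\<kappa> n = (\<nu> n - \<mu> n) / \<mu> n"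
definition \<eta> :: "nat \<Rightarrow> real" where "\<eta> n = (\<nu> n - \<mu> n)\<^sup>2 / \<mu> n"

definition ratio_second_moment :: "nat \<Rightarrow> real" where
  "ratio_second_moment n =
    exp ((\<delta> n)\<^sup>2 / (2 - (s n)\<^sup>2)) / (s n * sqrt (2 - (s n)\<^sup>2)) * exp (\<eta> n)"

definition complete_law :: "nat \<Rightarrow> (real \<times> nat) measure" where
  "complete_law n = normal_poisson 0 1 (\<mu> n)"

definition complete_ratio :: "nat \<Rightarrow> real \<times> nat \<Rightarrow> real" where
  "complete_ratio n = normal_poisson_ratio (\<delta> n) (s n) (\<nu> n) (\<mu> n)"

text \<open>The linearisation of \<open>complete_ratio n - 1\<close> at \<open>\<delta> n = 0\<close>, \<open>s n = 1\<close> and \<open>\<nu> n = \<mu> n\<close>.\<close>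

definition score :: "nat \<Rightarrow> real \<times> nat \<Rightarrow> real" where
  "score n z = normal_poisson_score (\<delta> n) (s n - 1) (\<kappa> n) (\<mu> n) (fst z) (real (snd z))"

definition increment :: "nat \<Rightarrow> real \<times> nat \<Rightarrow> real" where
  "increment n = jump_increment (d n) (\<tau> n)"

definition observed_ratio :: "nat \<Rightarrow> real \<Rightarrow> real" where
  "observed_ratio n y = increment_density (d' n) (\<tau>' n) (\<nu> n) y / increment_density (d n) (\<tau> n) (\<mu> n) y"

definition estimated_score :: "nat \<Rightarrow> real \<Rightarrow> real" where
  "estimated_score n = rounded_score (\<delta> n) (s n - 1) (\<kappa> n) (\<mu> n) (d n) (\<tau> n)"

lemma prob_space_complete_law: "prob_space (complete_law n)"
  unfolding complete_law_def by (rule prob_space_normal_poisson) simp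

lemma sets_complete_law [measurable_cong]: "sets (complete_law n) = sets (borel \<Otimes>\<^sub>M count_space UNIV)"
  unfolding complete_law_def by (rule sets_normal_poisson)

lemma score_measurable [measurable]: "score n \<in> borel_measurable (borel \<Otimes>\<^sub>M count_space UNIV)"
  unfolding score_def[abs_def] by measurable

lemma increment_measurable [measurable]: "increment n \<in> borel_measurable (borel \<Otimes>\<^sub>M count_space UNIV)"
  unfolding increment_def by measurable

lemma observed_ratio_measurable [measurable]: "observed_ratio n \<in> borel_measurable borel"
  unfolding observed_ratio_def[abs_def] by measurable

lemma \<delta>_tendsto_0: "\<delta> \<longlonglongrightarrow> 0"
  using tendsto_0_of_scaled[OF filterlim_sqrt_real_at_top mean_rate] by (simp add: \<delta>_def[abs_def])

lemma s_tendsto_1: "s \<longlonglongrightarrow> 1"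
  using tendsto_0_of_scaled[OF filterlim_sqrt_real_at_top scale_rate]
  by (simp add: s_def[abs_def] LIM_zero_iff)

lemma \<eta>_tendsto_0: "\<eta> \<longlonglongrightarrow> 0"
  using tendsto_0_of_scaled[OF filterlim_real_sequentially intensity_rate] by (simp add: \<eta>_def[abs_def])

lemma scaled_\<delta>_square_tendsto: "(\<lambda>n. real n * (\<delta> n)\<^sup>2) \<longlonglongrightarrow> a\<^sup>2"
  using tendsto_power[OF mean_rate, of 2]
  by (simp only: \<delta>_def power_mult_distrib real_sqrt_pow2 of_nat_0_le_iff)

lemma scaled_s_square_tendsto: "(\<lambda>n. real n * (s n - 1)\<^sup>2) \<longlonglongrightarrow> b\<^sup>2"
  using tendsto_power[OF scale_rate, of 2]
  by (simp only: s_def power_mult_distrib real_sqrt_pow2 of_nat_0_le_iff)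

lemma scaled_\<eta>_tendsto: "(\<lambda>n. real n * \<eta> n) \<longlonglongrightarrow> k"
  using intensity_rate by (simp add: \<eta>_def)

lemma \<kappa>_identities:
  shows "(\<kappa> n)\<^sup>2 * \<mu> n = \<eta> n" "\<kappa> n * (\<nu> n - \<mu> n) = \<eta> n" "(\<kappa> n * \<tau> n)\<^sup>2 = \<eta> n * ((\<tau> n)\<^sup>2 / \<mu> n)"
    "(\<kappa> n) ^ 4 * (\<mu> n + 3 * (\<mu> n)\<^sup>2) = (\<eta> n)\<^sup>2 / \<mu> n + 3 * (\<eta> n)\<^sup>2"
  using \<mu>_pos[of n] by (simp_all add: \<kappa>_def \<eta>_def field_simps eval_nat_numeral)

lemma eventually_regular: "\<forall>\<^sub>F n in sequentially. \<nu> n > 0 \<and> s n > 0 \<and> (s n)\<^sup>2 < 2"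
proof -
  have "(\<lambda>n. (s n)\<^sup>2) \<longlonglongrightarrow> 1\<^sup>2" by (intro tendsto_power s_tendsto_1)
  hence "\<forall>\<^sub>F n in sequentially. (s n)\<^sup>2 < 2" by (rule order_tendstoD(2)) simp
  moreover have "\<forall>\<^sub>F n in sequentially. s n > 0" using s_tendsto_1 by (rule order_tendstoD(1)) simp
  ultimately show ?thesis using eventually_\<nu>_pos by eventually_elim simp
qed

lemma scaled_ratio_second_moment_tendsto:
  "(\<lambda>n. real n * (ratio_second_moment n - 1)) \<longlonglongrightarrow> a\<^sup>2 + 2 * b\<^sup>2 + k"
proof -
  define C where "C n = 1 / (s n * sqrt (2 - (s n)\<^sup>2))" for n
  define V where "V n = (\<delta> n)\<^sup>2 / (2 - (s n)\<^sup>2) + \<eta> n" for n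
  have "C \<longlonglongrightarrow> 1 / (1 * sqrt (2 - 1\<^sup>2))"
    unfolding C_def[abs_def] by (intro tendsto_intros s_tendsto_1) simp_all
  hence C_lim: "C \<longlonglongrightarrow> 1" by simp
  have "((\<lambda>h::real. (1 / ((1 + h) * sqrt (2 - (1 + h)\<^sup>2)) - 1) / h\<^sup>2) \<longlongrightarrow> 2) (at 0)"
    by real_asymp
  moreover have "(\<lambda>n. s n - 1) \<longlonglongrightarrow> 0"
    using s_tendsto_1 by (simp add: LIM_zero_iff)
  ultimately have "(\<lambda>n. real n * (1 / ((1 + (s n - 1)) * sqrt (2 - (1 + (s n - 1))\<^sup>2)) - 1)) \<longlonglongrightarrow> 2 * b\<^sup>2"
    using scaled_s_square_tendsto
    by (intro tendsto_mult_compose_at_0[where g="\<lambda>h. h\<^sup>2"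
        and f="\<lambda>h. 1 / ((1 + h) * sqrt (2 - (1 + h)\<^sup>2)) - 1"]) auto
  hence scaled_C: "(\<lambda>n. real n * (C n - 1)) \<longlonglongrightarrow> 2 * b\<^sup>2"
    by (simp add: C_def)
  have "V \<longlonglongrightarrow> 0\<^sup>2 / (2 - 1\<^sup>2) + 0"
    unfolding V_def[abs_def] by (intro tendsto_intros \<delta>_tendsto_0 s_tendsto_1 \<eta>_tendsto_0) simp
  hence V_lim: "V \<longlonglongrightarrow> 0" by simp
  have "(\<lambda>n. (real n * (\<delta> n)\<^sup>2) / (2 - (s n)\<^sup>2) + real n * \<eta> n) \<longlonglongrightarrow> a\<^sup>2 / (2 - 1\<^sup>2) + k"
    by (intro tendsto_intros scaled_\<delta>_square_tendsto s_tendsto_1 scaled_\<eta>_tendsto) simp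
  hence scaled_V: "(\<lambda>n. real n * V n) \<longlonglongrightarrow> a\<^sup>2 + k"
    by (simp add: V_def distrib_left)
  have "((\<lambda>h::real. (exp h - 1) / h) \<longlongrightarrow> 1) (at 0)"
    by real_asymp
  hence scaled_exp: "(\<lambda>n. real n * (exp (V n) - 1)) \<longlonglongrightarrow> 1 * (a\<^sup>2 + k)"
    using V_lim scaled_V by (intro tendsto_mult_compose_at_0[where f="\<lambda>h. exp h - 1" and g="\<lambda>h. h"]) auto
  have "(\<lambda>n. (real n * (exp (V n) - 1)) * C n + real n * (C n - 1)) \<longlonglongrightarrow> (1 * (a\<^sup>2 + k)) * 1 + 2 * b\<^sup>2"
    by (intro tendsto_intros scaled_exp C_lim scaled_C)
  moreover have "ratio_second_moment n = exp (V n) * C n" for n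
    by (simp add: ratio_second_moment_def V_def C_def exp_add)
  ultimately show ?thesis by (simp add: algebra_simps)
qed

lemma score_second_moment:
  "has_bochner_integral (complete_law n) (\<lambda>z. (score n z)\<^sup>2) ((\<delta> n)\<^sup>2 + 2 * (s n - 1)\<^sup>2 + \<eta> n)"
  using normal_poisson_score_second_moment[OF \<mu>_pos[of n], of "\<delta> n" "s n - 1" "\<kappa> n"]
  by (simp add: complete_law_def score_def \<kappa>_identities)

lemma scaled_score_second_moment_tendsto:
  "(\<lambda>n. real n * (LINT z|complete_law n. (score n z)\<^sup>2)) \<longlonglongrightarrow> a\<^sup>2 + 2 * b\<^sup>2 + k"
proof -
  have "(\<lambda>n. real n * (\<delta> n)\<^sup>2 + 2 * (real n * (s n - 1)\<^sup>2) + real n * \<eta> n) \<longlonglongrightarrow> a\<^sup>2 + 2 * b\<^sup>2 + k"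
    by (intro tendsto_intros scaled_\<delta>_square_tendsto scaled_s_square_tendsto scaled_\<eta>_tendsto)
  moreover have "(LINT z|complete_law n. (score n z)\<^sup>2) = (\<delta> n)\<^sup>2 + 2 * (s n - 1)\<^sup>2 + \<eta> n" for n
    using score_second_moment by (simp add: has_bochner_integral_iff)
  ultimately show ?thesis by (simp add: algebra_simps)
qed

lemma integrable_score_fourth: "integrable (complete_law n) (\<lambda>z. score n z ^ 4)"
  unfolding complete_law_def score_def by (rule normal_poisson_score_fourth_moment(1)[OF \<mu>_pos])

lemma scaled_score_fourth_moment_tendsto: "(\<lambda>n. real n * (LINT z|complete_law n. score n z ^ 4)) \<longlonglongrightarrow> 0"
proof (rule Lim_null_comparison)
  let ?bound = "\<lambda>n. 27 * (3 * (real n * (\<delta> n)\<^sup>2 * (\<delta> n)\<^sup>2) + 60 * (real n * (s n - 1)\<^sup>2 * (s n - 1)\<^sup>2)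
      + ((real n * \<eta> n)\<^sup>2 / (real n * \<mu> n) + 3 * (real n * \<eta> n * \<eta> n)))"
  have "(\<lambda>n. (real n * \<eta> n)\<^sup>2 / (real n * \<mu> n)) \<longlonglongrightarrow> 0"
    by (rule real_tendsto_divide_at_top[OF tendsto_power[OF scaled_\<eta>_tendsto] n\<mu>_at_top])
  hence "?bound \<longlonglongrightarrow> 27 * (3 * (a\<^sup>2 * 0\<^sup>2) + 60 * (b\<^sup>2 * (1 - 1)\<^sup>2) + (0 + 3 * (k * 0)))"
    by (intro tendsto_intros scaled_\<delta>_square_tendsto scaled_s_square_tendsto scaled_\<eta>_tendsto
        \<delta>_tendsto_0 s_tendsto_1 \<eta>_tendsto_0)
  thus "?bound \<longlonglongrightarrow> 0" by simp
  show "\<forall>\<^sub>F n in sequentially. norm (real n * (LINT z|complete_law n. score n z ^ 4)) \<le> ?bound n"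
    using eventually_gt_at_top[of 0]
  proof eventually_elim
    case (elim n)
    have "(LINT z|complete_law n. score n z ^ 4)
        \<le> 27 * (3 * \<delta> n ^ 4 + 60 * (s n - 1) ^ 4 + ((\<eta> n)\<^sup>2 / \<mu> n + 3 * (\<eta> n)\<^sup>2))"
      using normal_poisson_score_fourth_moment(2)[OF \<mu>_pos[of n], of "\<delta> n" "s n - 1" "\<kappa> n"]
      by (simp only: complete_law_def score_def \<kappa>_identities)
    hence "real n * (LINT z|complete_law n. score n z ^ 4)
        \<le> real n * (27 * (3 * \<delta> n ^ 4 + 60 * (s n - 1) ^ 4 + ((\<eta> n)\<^sup>2 / \<mu> n + 3 * (\<eta> n)\<^sup>2)))"
      by (rule mult_left_mono) simp
    also have "\<dots> = ?bound n"
      using elim by (simp add: power2_eq_square power4_eq_xxxx algebra_simps)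
    finally show ?case by (simp add: abs_of_nonneg integral_nonneg)
  qed
qed

lemma ratio_remainder_moment:
  assumes "\<nu> n > 0" "s n > 0" "(s n)\<^sup>2 < 2"
  shows "has_bochner_integral (complete_law n) (\<lambda>z. (complete_ratio n z - (1 + score n z))\<^sup>2)
    (ratio_second_moment n - 1 - (\<delta> n)\<^sup>2 - 2 * s n * (s n - 1)\<^sup>2 - 2 * (s n - 1) * (\<delta> n)\<^sup>2 - \<eta> n)"
proof -
  have "x - 1 + ((\<delta> n)\<^sup>2 + 2 * (s n - 1)\<^sup>2 + (\<kappa> n)\<^sup>2 * \<mu> n)
      - 2 * (\<delta> n * \<delta> n + (s n - 1) * ((s n)\<^sup>2 + (\<delta> n)\<^sup>2 - 1) + \<kappa> n * (\<nu> n - \<mu> n))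
    = x - 1 - (\<delta> n)\<^sup>2 - 2 * s n * (s n - 1)\<^sup>2 - 2 * (s n - 1) * (\<delta> n)\<^sup>2 - \<eta> n" for x
    unfolding \<kappa>_identities by (simp add: power2_eq_square algebra_simps)
  thus ?thesis
    using normal_poisson_ratio_remainder_moment[OF \<mu>_pos[of n] assms,
        where \<delta>="\<delta> n" and \<alpha>="\<delta> n" and \<beta>="s n - 1" and \<kappa>="\<kappa> n"]
    by (simp only: complete_law_def complete_ratio_def score_def ratio_second_moment_def \<eta>_def[symmetric])
qed

lemma scaled_ratio_remainder_tendsto:
  "(\<lambda>n. real n * (LINT z|complete_law n. (complete_ratio n z - (1 + score n z))\<^sup>2)) \<longlonglongrightarrow> 0"
proof -
  let ?moment = "\<lambda>n. real n * (ratio_second_moment n - 1) - real n * (\<delta> n)\<^sup>2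
      - 2 * s n * (real n * (s n - 1)\<^sup>2) - 2 * (s n - 1) * (real n * (\<delta> n)\<^sup>2) - real n * \<eta> n"
  have "?moment \<longlonglongrightarrow> (a\<^sup>2 + 2 * b\<^sup>2 + k) - a\<^sup>2 - 2 * 1 * b\<^sup>2 - 2 * (1 - 1) * a\<^sup>2 - k"
    by (intro tendsto_intros scaled_ratio_second_moment_tendsto scaled_\<delta>_square_tendsto
        scaled_s_square_tendsto scaled_\<eta>_tendsto s_tendsto_1)
  hence "?moment \<longlonglongrightarrow> 0" by simp
  thus ?thesis
  proof (rule Lim_transform_eventually)
    show "\<forall>\<^sub>F n in sequentially.
        ?moment n = real n * (LINT z|complete_law n. (complete_ratio n z - (1 + score n z))\<^sup>2)"
      using eventually_regular
    proof eventually_elim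
      case (elim n)
      have "(LINT z|complete_law n. (complete_ratio n z - (1 + score n z))\<^sup>2) =
          ratio_second_moment n - 1 - (\<delta> n)\<^sup>2 - 2 * s n * (s n - 1)\<^sup>2 - 2 * (s n - 1) * (\<delta> n)\<^sup>2 - \<eta> n"
        using ratio_remainder_moment elim by (simp add: has_bochner_integral_iff)
      thus ?case by (simp add: right_diff_distrib mult.left_commute)
    qed
  qed
qed

lemma estimated_score_measurable [measurable]: "estimated_score n \<in> borel_measurable borel"
  unfolding estimated_score_def by measurable

lemma integrable_rounding_error:
  "integrable (complete_law n) (\<lambda>z. (score n z - estimated_score n (increment n z))\<^sup>2)"
  unfolding complete_law_def score_def estimated_score_def increment_def
  by (rule rounded_score_error_moment(1)[OF \<tau>_pos])

lemma scaled_rounding_error_tendsto: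
  "(\<lambda>n. real n * (LINT z|complete_law n. (score n z - estimated_score n (increment n z))\<^sup>2)) \<longlonglongrightarrow> 0"
proof (rule Lim_null_comparison)
  let ?error = "\<lambda>n. LINT z|complete_law n. (score n z - estimated_score n (increment n z))\<^sup>2"
  let ?bound = "\<lambda>n. 48 * (3 * ((\<tau> n)\<^sup>2 * (real n * (\<delta> n)\<^sup>2) + (\<tau> n)\<^sup>2 * ((\<tau> n)\<^sup>2 / \<mu> n) * (real n * \<eta> n))
      + 60 * ((\<tau> n)\<^sup>2 * (real n * (s n - 1)\<^sup>2)))"
  have "(\<lambda>n. (\<tau> n)\<^sup>2) \<longlonglongrightarrow> 0\<^sup>2"
    by (intro tendsto_power \<tau>_tendsto_0)
  moreover obtain B where "\<And>n. norm ((\<tau> n)\<^sup>2 / \<mu> n) \<le> B"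
    using \<tau>_\<mu>_bounded by (auto simp: Bseq_def)
  ultimately have "(\<lambda>n. (\<tau> n)\<^sup>2 * ((\<tau> n)\<^sup>2 / \<mu> n)) \<longlonglongrightarrow> 0"
    by (intro lim_null_mult_right_bounded[where B=B]) auto
  from tendsto_mult[OF this scaled_\<eta>_tendsto]
  have "(\<lambda>n. (\<tau> n)\<^sup>2 * ((\<tau> n)\<^sup>2 / \<mu> n) * (real n * \<eta> n)) \<longlonglongrightarrow> 0" by simp
  hence "?bound \<longlonglongrightarrow> 48 * (3 * (0\<^sup>2 * a\<^sup>2 + 0) + 60 * (0\<^sup>2 * b\<^sup>2))"
    by (intro tendsto_intros \<tau>_tendsto_0 scaled_\<delta>_square_tendsto scaled_s_square_tendsto)
  thus "?bound \<longlonglongrightarrow> 0" by simp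
  have "norm (real n * ?error n) \<le> ?bound n" for n
  proof -
    have "?error n \<le> 48 * (\<tau> n)\<^sup>2 * (3 * ((\<delta> n)\<^sup>2 + \<eta> n * ((\<tau> n)\<^sup>2 / \<mu> n)) + 60 * (s n - 1)\<^sup>2)"
      using rounded_score_error_moment(2)[OF \<tau>_pos[of n], of "\<mu> n" "\<delta> n" "s n - 1" "\<kappa> n" "d n"]
      by (simp only: complete_law_def score_def estimated_score_def increment_def \<kappa>_identities)
    hence "real n * ?error n
        \<le> real n * (48 * (\<tau> n)\<^sup>2 * (3 * ((\<delta> n)\<^sup>2 + \<eta> n * ((\<tau> n)\<^sup>2 / \<mu> n)) + 60 * (s n - 1)\<^sup>2))"
      by (rule mult_left_mono) simp
    thus ?thesis
      by (simp add: abs_of_nonneg integral_nonneg algebra_simps)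
  qed
  thus "\<forall>\<^sub>F n in sequentially. norm (real n * ?error n) \<le> ?bound n"
    by (intro always_eventually allI)
qed

lemma image_density_observed_ratio:
  assumes "\<nu> n > 0" "s n > 0"
  shows "image_density (complete_law n) borel (increment n) (complete_ratio n) (observed_ratio n)"
proof -
  have "d n + \<tau> n * \<delta> n = d' n" "\<tau> n * s n = \<tau>' n"
    using \<tau>_pos[of n] by (simp_all add: \<delta>_def s_def)
  thus ?thesis
    using image_density_jump_increment[OF \<mu>_pos[of n] assms \<tau>_pos[of n], of "d n" "\<delta> n"]
    unfolding complete_law_def complete_ratio_def increment_def observed_ratio_def[abs_def] by simp
qed

lemma eventually_observed_ratio_mean:
  "\<forall>\<^sub>F n in sequentially. has_bochner_integral (complete_law n) (\<lambda>z. observed_ratio n (increment n z) - 1) 0"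
  using eventually_regular
proof eventually_elim
  case (elim n)
  interpret image_density "complete_law n" borel "increment n" "complete_ratio n" "observed_ratio n"
    using elim by (intro image_density_observed_ratio) auto
  have "integral\<^sup>L (complete_law n) (complete_ratio n) = 1"
    using normal_poisson_ratio_mean[OF \<mu>_pos[of n], of "\<nu> n" "s n" "\<delta> n"] elim
    by (simp add: has_bochner_integral_iff complete_law_def complete_ratio_def)
  hence "has_bochner_integral (complete_law n) (\<lambda>z. observed_ratio n (increment n z)) 1"
    using has_bochner_integral_image_density by simp
  thus ?case
    by (auto simp: has_bochner_integral_iff prob_space)
qed

lemma observed_ratio_score_error:
  assumes "\<nu> n > 0" "s n > 0" "(s n)\<^sup>2 < 2"
  shows "integrable (complete_law n) (\<lambda>z. (observed_ratio n (increment n z) - (1 + score n z))\<^sup>2)"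
    and "(LINT z|complete_law n. (observed_ratio n (increment n z) - (1 + score n z))\<^sup>2)
      \<le> 4 * (LINT z|complete_law n. (complete_ratio n z - (1 + score n z))\<^sup>2)
        + 6 * (LINT z|complete_law n. (score n z - estimated_score n (increment n z))\<^sup>2)"
proof -
  interpret image_density "complete_law n" borel "increment n" "complete_ratio n" "observed_ratio n"
    by (rule image_density_observed_ratio[OF assms(1,2)])
  have R_error: "integrable (complete_law n) (\<lambda>z. (complete_ratio n z - (1 + score n z))\<^sup>2)"
    using ratio_remainder_moment[OF assms(1-3)] by (simp add: has_bochner_integral_iff)
  have rounding: "integrable (complete_law n)
      (\<lambda>z. ((1 + score n z) - (1 + estimated_score n (increment n z)))\<^sup>2)"
    using integrable_rounding_error by simp
  have "(\<lambda>z. 1 + score n z) \<in> borel_measurable (complete_law n)"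
    "(\<lambda>y. 1 + estimated_score n y) \<in> borel_measurable borel"
    by measurable
  from image_density_L2_error[OF this R_error rounding]
  show "integrable (complete_law n) (\<lambda>z. (observed_ratio n (increment n z) - (1 + score n z))\<^sup>2)"
    "(LINT z|complete_law n. (observed_ratio n (increment n z) - (1 + score n z))\<^sup>2)
      \<le> 4 * (LINT z|complete_law n. (complete_ratio n z - (1 + score n z))\<^sup>2)
        + 6 * (LINT z|complete_law n. (score n z - estimated_score n (increment n z))\<^sup>2)"
    by simp_all
qed

lemma scaled_observed_ratio_score_error_tendsto:
  "(\<lambda>n. real n * (LINT z|complete_law n. (observed_ratio n (increment n z) - (1 + score n z))\<^sup>2)) \<longlonglongrightarrow> 0"
proof (rule Lim_null_comparison)
  let ?e = "\<lambda>n. LINT z|complete_law n. (complete_ratio n z - (1 + score n z))\<^sup>2"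
  let ?e' = "\<lambda>n. LINT z|complete_law n. (score n z - estimated_score n (increment n z))\<^sup>2"
  have "(\<lambda>n. 4 * (real n * ?e n) + 6 * (real n * ?e' n)) \<longlonglongrightarrow> 4 * 0 + 6 * 0"
    by (intro tendsto_intros scaled_ratio_remainder_tendsto scaled_rounding_error_tendsto)
  thus "(\<lambda>n. 4 * (real n * ?e n) + 6 * (real n * ?e' n)) \<longlonglongrightarrow> 0" by simp
  show "\<forall>\<^sub>F n in sequentially.
      norm (real n * (LINT z|complete_law n. (observed_ratio n (increment n z) - (1 + score n z))\<^sup>2))
      \<le> 4 * (real n * ?e n) + 6 * (real n * ?e' n)"
    using eventually_regular
  proof eventually_elim
    case (elim n)
    hence "(LINT z|complete_law n. (observed_ratio n (increment n z) - (1 + score n z))\<^sup>2)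
        \<le> 4 * ?e n + 6 * ?e' n"
      using observed_ratio_score_error(2) by blast
    from mult_left_mono[OF this, of "real n"]
    show ?case by (simp add: abs_of_nonneg integral_nonneg distrib_left mult.left_commute)
  qed
qed

lemma scaled_char_log_density_ratio_tendsto:
  "(\<lambda>n. of_nat n * (char (distr (density lborel (increment_density (d n) (\<tau> n) (\<mu> n))) borel
      (\<lambda>y. ln (observed_ratio n y))) t - 1))
    \<longlonglongrightarrow> lan_exponent t * of_real (a\<^sup>2 + 2 * b\<^sup>2 + k)"
proof -
  have "(\<lambda>n. of_nat n *
      ((CLINT z|complete_law n. iexp (t * ln (1 + (observed_ratio n (increment n z) - 1)))) - 1))
      \<longlonglongrightarrow> lan_exponent t * of_real (a\<^sup>2 + 2 * b\<^sup>2 + k)"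
  proof (rule scaled_char_ln_tendsto[where S=score])
    show "\<forall>\<^sub>F n in sequentially.
        integrable (complete_law n) (\<lambda>z. (observed_ratio n (increment n z) - 1 - score n z)\<^sup>2)"
      using eventually_regular
      by eventually_elim (use observed_ratio_score_error(1) in \<open>simp add: diff_diff_eq\<close>)
    show "(\<lambda>n. real n * (LINT z|complete_law n. (observed_ratio n (increment n z) - 1 - score n z)\<^sup>2)) \<longlonglongrightarrow> 0"
      using scaled_observed_ratio_score_error_tendsto by (simp add: diff_diff_eq)
    show "integrable (complete_law n) (\<lambda>z. (score n z)\<^sup>2)" for n
      using score_second_moment by (auto simp: has_bochner_integral_iff)
    show "(\<lambda>z. observed_ratio n (increment n z) - 1) \<in> borel_measurable (complete_law n)" for n
      by measurable
  qed (rule prob_space_complete_law scaled_score_second_moment_tendsto integrable_score_fourth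
      scaled_score_fourth_moment_tendsto eventually_observed_ratio_mean)+
  moreover have "char (distr (density lborel (increment_density (d n) (\<tau> n) (\<mu> n))) borel
      (\<lambda>y. ln (observed_ratio n y))) t =
      (CLINT z|complete_law n. iexp (t * ln (1 + (observed_ratio n (increment n z) - 1))))" for n
  proof -
    have law: "density lborel (increment_density (d n) (\<tau> n) (\<mu> n)) =
        distr (complete_law n) borel (increment n)"
      using distr_jump_increment[of 1 "\<tau> n" 0 "\<mu> n" "d n"] \<tau>_pos by (simp add: complete_law_def increment_def)
    show ?thesis
      unfolding law char_def by (simp add: integral_distr)
  qed
  ultimately show ?thesis by simp
qed

lemma weak_conv_m_log_density_ratio:
  fixes M :: "'a measure" and Y :: "nat \<Rightarrow> nat \<Rightarrow> 'a \<Rightarrow> real"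
  assumes M: "prob_space M"
    and indep: "\<And>n. prob_space.indep_vars M (\<lambda>_. borel) (Y n) {..<n}"
    and law: "\<And>n i. i < n \<Longrightarrow> distr M borel (Y n i) = density lborel (increment_density (d n) (\<tau> n) (\<mu> n))"
    and k_nonneg: "k \<ge> 0"
  shows "weak_conv_m (\<lambda>n. distr M borel (\<lambda>\<omega>. \<Sum>i<n. ln (observed_ratio n (Y n i \<omega>))))
    (lan_limit_law (a\<^sup>2 + 2 * b\<^sup>2 + k))"
proof -
  interpret prob_space M by fact
  show ?thesis
  proof (rule weak_conv_m_row_sums[OF _ _ _ scaled_char_log_density_ratio_tendsto])
    show "indep_vars (\<lambda>_. borel) (\<lambda>i \<omega>. ln (observed_ratio n (Y n i \<omega>))) {..<n}" for n
      by (rule indep_vars_compose2[OF indep]) measurable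
    show "distr M borel (\<lambda>\<omega>. ln (observed_ratio n (Y n i \<omega>))) =
        distr (density lborel (increment_density (d n) (\<tau> n) (\<mu> n))) borel (\<lambda>y. ln (observed_ratio n y))"
      if "i < n" for n i
    proof -
      have [measurable]: "random_variable borel (Y n i)"
        using indep[of n] that by (auto simp: indep_vars_def2)
      show ?thesis
        unfolding law[OF that, symmetric] by (simp add: distr_distr comp_def)
    qed
    show "real_distribution (lan_limit_law (a\<^sup>2 + 2 * b\<^sup>2 + k))"
      unfolding lan_limit_law_def
      by (intro prob_space.real_distribution_distr prob_space_normal_density) auto
    show "char (lan_limit_law (a\<^sup>2 + 2 * b\<^sup>2 + k)) t = exp (lan_exponent t * of_real (a\<^sup>2 + 2 * b\<^sup>2 + k))" for t
      using k_nonneg by (intro char_lan_limit_law) simp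
  qed
qed

end

section \<open>The observed process\<close>

lemma trans_dens_eq_increment_density:
  assumes "lam > 0" "\<Delta> > 0"
  shows "trans_dens \<theta> \<sigma> lam \<Delta> x y = increment_density ((\<theta> - lam) * \<Delta>) (\<sigma> * sqrt \<Delta>) (lam * \<Delta>) (y - x)"
proof -
  have "(\<sigma> * sqrt \<Delta>)\<^sup>2 = \<sigma>\<^sup>2 * \<Delta>"
    using assms by (simp add: power_mult_distrib)
  hence "exp (- lam * \<Delta>) * (lam * \<Delta>) ^ m / fact m * (1 / sqrt (2 * pi * \<sigma>\<^sup>2 * \<Delta>))
      * exp (- (y - x - (\<theta> - lam) * \<Delta> - real m)\<^sup>2 / (2 * \<sigma>\<^sup>2 * \<Delta>)) =
      pmf (poisson_pmf (lam * \<Delta>)) m * normal_density ((\<theta> - lam) * \<Delta> + real m) (\<sigma> * sqrt \<Delta>) (y - x)" for m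
    using assms by (simp add: normal_density_def mult.assoc add.assoc diff_diff_eq)
  thus ?thesis
    unfolding trans_dens_def increment_density_def by simp
qed

lemma ln_likelihood_ratio:
  assumes "\<Delta> > 0" "\<sigma> > 0" "lam > 0" "\<sigma>' > 0" "lam' > 0"
  shows "ln (likelihood \<theta>' \<sigma>' lam' \<Delta> n xs / likelihood \<theta> \<sigma> lam \<Delta> n xs) =
    (\<Sum>i<n. ln (increment_density ((\<theta>' - lam') * \<Delta>) (\<sigma>' * sqrt \<Delta>) (lam' * \<Delta>) (xs (Suc i) - xs i) /
      increment_density ((\<theta> - lam) * \<Delta>) (\<sigma> * sqrt \<Delta>) (lam * \<Delta>) (xs (Suc i) - xs i)))"
proof -
  have "increment_density c (\<sigma>' * sqrt \<Delta>) (lam' * \<Delta>) y \<noteq> 0"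
    "increment_density c (\<sigma> * sqrt \<Delta>) (lam * \<Delta>) y \<noteq> 0" for c y
    using increment_density_pos[of "\<sigma>' * sqrt \<Delta>" "lam' * \<Delta>" c y]
      increment_density_pos[of "\<sigma> * sqrt \<Delta>" "lam * \<Delta>" c y] assms by simp_all
  thus ?thesis
    unfolding likelihood_def prod_dividef[symmetric]
      trans_dens_eq_increment_density[OF assms(3,1)] trans_dens_eq_increment_density[OF assms(5,1)]
    by (intro ln_prod) simp_all
qed

lemma (in prob_space) indep_vars_imp_indep_var:
  assumes "indep_vars M' X I" "i \<in> I" "j \<in> I" "i \<noteq> j"
  shows "indep_var (M' i) (X i) (M' j) (X j)"
proof -
  have "indep_var (PiM {i} M') (\<lambda>\<omega>. restrict (\<lambda>i. X i \<omega>) {i}) (PiM {j} M') (\<lambda>\<omega>. restrict (\<lambda>i. X i \<omega>) {j})"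
    using assms by (intro indep_var_restrict) auto
  from indep_var_compose[OF this, of "\<lambda>f. f i" "M' i" "\<lambda>f. f j" "M' j"]
  show ?thesis by (simp add: comp_def)
qed

lemma (in prob_space) distr_eq_poisson:
  fixes K :: "'a \<Rightarrow> real"
  assumes [measurable]: "K \<in> borel_measurable M" and nat: "AE \<omega> in M. K \<omega> \<in> \<nat>" and \<mu>: "\<mu> > 0"
    and prob_eq: "\<And>k. prob {\<omega> \<in> space M. K \<omega> = real k} = \<mu> ^ k / fact k * exp (- \<mu>)"
  shows "distr M borel K = distr (measure_pmf (poisson_pmf \<mu>)) borel real"
proof -
  define K' where "K' \<omega> = nat \<lfloor>K \<omega>\<rfloor>" for \<omega>
  have [measurable]: "K' \<in> measurable M (count_space UNIV)" unfolding K'_def by measurable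
  have K_K': "AE \<omega> in M. K \<omega> = real (K' \<omega>)"
    using nat by eventually_elim (auto simp: K'_def elim!: Nats_cases)
  have "distr M (count_space UNIV) K' = measure_pmf (poisson_pmf \<mu>)"
  proof (rule measure_eqI_countable[where A=UNIV])
    fix k :: nat
    have "emeasure (distr M (count_space UNIV) K') {k} = emeasure M {\<omega> \<in> space M. K' \<omega> = k}"
      by (subst emeasure_distr) (auto intro!: arg_cong2[where f=emeasure])
    also have "\<dots> = emeasure M {\<omega> \<in> space M. K \<omega> = real k}"
      by (rule emeasure_eq_AE) (use K_K' in eventually_elim, auto)
    also have "\<dots> = ennreal (pmf (poisson_pmf \<mu>) k)"
      using \<mu> by (simp add: emeasure_eq_measure prob_eq)
    finally show "emeasure (distr M (count_space UNIV) K') {k} = emeasure (measure_pmf (poisson_pmf \<mu>)) {k}"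
      by (simp add: emeasure_pmf_single)
  qed auto
  hence "distr (measure_pmf (poisson_pmf \<mu>)) borel real = distr M borel (\<lambda>\<omega>. real (K' \<omega>))"
    by (subst distr_distr[symmetric, where N="count_space UNIV", unfolded comp_def]) simp_all
  also have "\<dots> = distr M borel K"
    by (rule distr_cong_AE) (use K_K' in auto)
  finally show ?thesis ..
qed

lemma bm_poissonD:
  assumes "bm_poisson M B N lam"
  shows "prob_space M" "B t \<in> borel_measurable M" "N t \<in> borel_measurable M"
  using assms by (auto simp: bm_poisson_def)

lemma bm_poisson_indep_vars:
  fixes ts :: "nat \<Rightarrow> real"
  assumes "bm_poisson M B N lam" "0 \<le> ts 0" "\<And>i. i < m \<Longrightarrow> ts i < ts (Suc i)"
  shows "prob_space.indep_vars M (\<lambda>_. borel)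
    (\<lambda>j. case j of Inl i \<Rightarrow> (\<lambda>\<omega>. B (ts (Suc i)) \<omega> - B (ts i) \<omega>) | Inr i \<Rightarrow> (\<lambda>\<omega>. N (ts (Suc i)) \<omega> - N (ts i) \<omega>))
    ({..<m} <+> {..<m})"
  using assms unfolding bm_poisson_def by blast

lemma bm_poisson_AE_increment_nat:
  assumes "bm_poisson M B N lam" "0 \<le> s" "s < t"
  shows "AE \<omega> in M. N t \<omega> - N s \<omega> \<in> \<nat>"
proof -
  have "AE \<omega> in M. (\<forall>t\<ge>0. N t \<omega> \<in> \<nat>) \<and> mono_on {0..} (\<lambda>t. N t \<omega>)"
    using assms(1) unfolding bm_poisson_def by (auto elim!: eventually_mono)
  thus ?thesis
  proof eventually_elim
    case (elim \<omega>)
    have "N s \<omega> \<le> N t \<omega>" using elim assms(2,3) by (auto simp: mono_on_def)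
    moreover obtain i j where "N s \<omega> = real i" "N t \<omega> = real j"
      using elim assms(2,3) by (metis Nats_cases less_eq_real_def order_trans)
    ultimately show ?case
      by (metis of_nat_diff of_nat_in_Nats of_nat_le_iff)
  qed
qed

lemma bm_poisson_joint_increment_law:
  assumes bp: "bm_poisson M B N lam" and lam: "lam > 0" and st: "0 \<le> s" "s < t"
  shows "distr M (borel \<Otimes>\<^sub>M borel) (\<lambda>\<omega>. (B t \<omega> - B s \<omega>, N t \<omega> - N s \<omega>)) =
    distr (normal_poisson 0 (sqrt (t - s)) (lam * (t - s))) (borel \<Otimes>\<^sub>M borel) (\<lambda>(g, m). (g, real m))"
proof -
  interpret prob_space M by (rule bm_poissonD(1)[OF bp])
  note [measurable] = bm_poissonD(2,3)[OF bp]
  let ?normal = "density lborel (normal_density 0 (sqrt (t - s)))"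
    and ?poisson = "measure_pmf (poisson_pmf (lam * (t - s)))"
  interpret normal: prob_space ?normal using st by (intro prob_space_normal_density) simp
  define ts :: "nat \<Rightarrow> real" where "ts i = (if i = 0 then s else t)" for i
  have "indep_vars (\<lambda>_. borel) (\<lambda>j. case j of Inl i \<Rightarrow> (\<lambda>\<omega>. B (ts (Suc i)) \<omega> - B (ts i) \<omega>)
      | Inr i \<Rightarrow> (\<lambda>\<omega>. N (ts (Suc i)) \<omega> - N (ts i) \<omega>)) ({..<1} <+> {..<1})"
    by (rule bm_poisson_indep_vars[OF bp]) (use st in \<open>simp_all add: ts_def\<close>)
  from indep_vars_imp_indep_var[OF this InlI InrI, of 0 0]
  have "indep_var borel (\<lambda>\<omega>. B t \<omega> - B s \<omega>) borel (\<lambda>\<omega>. N t \<omega> - N s \<omega>)"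
    by (simp add: ts_def)
  hence "distr M (borel \<Otimes>\<^sub>M borel) (\<lambda>\<omega>. (B t \<omega> - B s \<omega>, N t \<omega> - N s \<omega>)) =
      distr M borel (\<lambda>\<omega>. B t \<omega> - B s \<omega>) \<Otimes>\<^sub>M distr M borel (\<lambda>\<omega>. N t \<omega> - N s \<omega>)"
    by (simp add: indep_var_distribution_eq)
  also have "distr M borel (\<lambda>\<omega>. N t \<omega> - N s \<omega>) = distr ?poisson borel real"
    by (rule distr_eq_poisson)
       (use bp st lam bm_poisson_AE_increment_nat[OF bp st] in \<open>simp_all add: bm_poisson_def\<close>)
  also have "distr M borel (\<lambda>\<omega>. B t \<omega> - B s \<omega>) = distr ?normal borel (\<lambda>g. g)"
    using bp st by (simp add: bm_poisson_def distr_id2)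
  also have "distr ?normal borel (\<lambda>g. g) \<Otimes>\<^sub>M distr ?poisson borel real =
      distr (normal_poisson 0 (sqrt (t - s)) (lam * (t - s))) (borel \<Otimes>\<^sub>M borel) (\<lambda>(g, m). (g, real m))"
    unfolding normal_poisson_def
    by (rule pair_measure_distr)
       (auto intro!: prob_space_imp_sigma_finite measure_pmf.prob_space_distr)
  finally show ?thesis .
qed

lemma bm_poisson_increment_law:
  assumes bp: "bm_poisson M B N lam" and "lam > 0" "\<sigma> > 0" "0 \<le> s" "s < t"
  shows "distr M borel (\<lambda>\<omega>. c + \<sigma> * (B t \<omega> - B s \<omega>) + (N t \<omega> - N s \<omega>)) =
    density lborel (increment_density c (\<sigma> * sqrt (t - s)) (lam * (t - s)))"
proof -
  note [measurable] = bm_poissonD(2,3)[OF bp]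
  have "distr M borel (\<lambda>\<omega>. c + \<sigma> * (B t \<omega> - B s \<omega>) + (N t \<omega> - N s \<omega>)) =
      distr (distr M (borel \<Otimes>\<^sub>M borel) (\<lambda>\<omega>. (B t \<omega> - B s \<omega>, N t \<omega> - N s \<omega>))) borel
        (\<lambda>p. c + \<sigma> * fst p + snd p)"
    by (subst distr_distr) (simp_all add: comp_def)
  also have "\<dots> = distr (normal_poisson 0 (sqrt (t - s)) (lam * (t - s))) borel (jump_increment c \<sigma>)"
    unfolding bm_poisson_joint_increment_law[OF bp assms(2,4,5)]
    by (subst distr_distr) (simp_all add: comp_def case_prod_beta' jump_increment_def[abs_def])
  also have "\<dots> = density lborel (increment_density c (\<sigma> * sqrt (t - s)) (lam * (t - s)))"
    using distr_jump_increment[of "sqrt (t - s)" \<sigma> 0] assms by simp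
  finally show ?thesis .
qed

lemma bm_poisson_indep_increments:
  assumes bp: "bm_poisson M B N lam" and \<Delta>: "\<Delta> > 0"
  shows "prob_space.indep_vars M (\<lambda>_. borel)
    (\<lambda>i \<omega>. c + \<sigma> * (B (real (Suc i) * \<Delta>) \<omega> - B (real i * \<Delta>) \<omega>) +
      (N (real (Suc i) * \<Delta>) \<omega> - N (real i * \<Delta>) \<omega>)) {..<n}"
proof -
  interpret prob_space M by (rule bm_poissonD(1)[OF bp])
  let ?X = "\<lambda>j. case j of Inl i \<Rightarrow> (\<lambda>\<omega>. B (real (Suc i) * \<Delta>) \<omega> - B (real i * \<Delta>) \<omega>)
      | Inr i \<Rightarrow> (\<lambda>\<omega>. N (real (Suc i) * \<Delta>) \<omega> - N (real i * \<Delta>) \<omega>)"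
  have "indep_vars (\<lambda>_. borel) ?X ({..<n} <+> {..<n})"
    by (rule bm_poisson_indep_vars[OF bp, where ts="\<lambda>i. real i * \<Delta>"]) (use \<Delta> in simp_all)
  hence "indep_vars (\<lambda>i. PiM {Inl i, Inr i} (\<lambda>_. borel)) (\<lambda>i \<omega>. restrict (\<lambda>j. ?X j \<omega>) {Inl i, Inr i}) {..<n}"
    by (rule indep_vars_restrict) (auto simp: disjoint_family_on_def)
  hence "indep_vars (\<lambda>_. borel)
      (\<lambda>i \<omega>. (\<lambda>f. c + \<sigma> * f (Inl i) + f (Inr i)) (restrict (\<lambda>j. ?X j \<omega>) {Inl i, Inr i})) {..<n}"
    by (rule indep_vars_compose2) measurable
  thus ?thesis by simp
qed

lemma jump_diffusion_increments:
  assumes bp: "bm_poisson M B N lam" and "lam > 0" "\<sigma> > 0" and \<Delta>: "\<Delta> > 0"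
    and X: "\<And>t \<omega>. X t \<omega> = x + \<theta> * t + \<sigma> * B t \<omega> + N t \<omega> - lam * t"
  shows "prob_space.indep_vars M (\<lambda>_. borel) (\<lambda>i \<omega>. X (real (Suc i) * \<Delta>) \<omega> - X (real i * \<Delta>) \<omega>) {..<n}"
    and "distr M borel (\<lambda>\<omega>. X (real (Suc i) * \<Delta>) \<omega> - X (real i * \<Delta>) \<omega>) =
      density lborel (increment_density ((\<theta> - lam) * \<Delta>) (\<sigma> * sqrt \<Delta>) (lam * \<Delta>))"
proof -
  have increment: "X (real (Suc i) * \<Delta>) \<omega> - X (real i * \<Delta>) \<omega> = (\<theta> - lam) * \<Delta> +
      \<sigma> * (B (real (Suc i) * \<Delta>) \<omega> - B (real i * \<Delta>) \<omega>) + (N (real (Suc i) * \<Delta>) \<omega> - N (real i * \<Delta>) \<omega>)" for i \<omega>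
    by (simp add: X algebra_simps)
  show "prob_space.indep_vars M (\<lambda>_. borel) (\<lambda>i \<omega>. X (real (Suc i) * \<Delta>) \<omega> - X (real i * \<Delta>) \<omega>) {..<n}"
    unfolding increment by (rule bm_poisson_indep_increments[OF bp \<Delta>])
  show "distr M borel (\<lambda>\<omega>. X (real (Suc i) * \<Delta>) \<omega> - X (real i * \<Delta>) \<omega>) =
      density lborel (increment_density ((\<theta> - lam) * \<Delta>) (\<sigma> * sqrt \<Delta>) (lam * \<Delta>))"
    unfolding increment using bm_poisson_increment_law[OF assms(1-3), of "real i * \<Delta>" "real (Suc i) * \<Delta>"] \<Delta>
    by (simp add: left_diff_distrib[symmetric])
qed

lemma eventually_add_divide_pos:
  fixes c y :: real
  assumes "c > 0" "filterlim f at_top F"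
  shows "\<forall>\<^sub>F n in F. c + y / f n > 0"
proof -
  have "((\<lambda>n. c + y / f n) \<longlongrightarrow> c + 0) F"
    by (intro tendsto_add tendsto_const real_tendsto_divide_at_top[OF tendsto_const assms(2)])
  thus ?thesis using assms(1) by (intro order_tendstoD(1)) auto
qed

lemma increment_parameter_rates:
  fixes m \<Delta> \<sigma> lam \<theta> u v w :: real
  assumes "m > 0" "\<Delta> > 0" "\<sigma> > 0" "lam > 0"
  defines "\<theta>' \<equiv> \<theta> + u / sqrt (m * \<Delta>)" and "\<sigma>' \<equiv> \<sigma> + v / sqrt m" and "lam' \<equiv> lam + w / sqrt (m * \<Delta>)"
  shows "sqrt m * (((\<theta>' - lam') * \<Delta> - (\<theta> - lam) * \<Delta>) / (\<sigma> * sqrt \<Delta>)) = (u - w) / \<sigma>"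
    and "sqrt m * (\<sigma>' * sqrt \<Delta> / (\<sigma> * sqrt \<Delta>) - 1) = v / \<sigma>"
    and "m * ((lam' * \<Delta> - lam * \<Delta>)\<^sup>2 / (lam * \<Delta>)) = w\<^sup>2 / lam"
proof -
  define p q where "p = sqrt m" and "q = sqrt \<Delta>"
  have p: "p > 0" "m = p\<^sup>2" and q: "q > 0" "\<Delta> = q\<^sup>2"
    using assms(1,2) by (simp_all add: p_def q_def)
  have sqrt: "sqrt m = p" "sqrt \<Delta> = q" "sqrt (m * \<Delta>) = p * q"
    by (simp_all add: p_def q_def real_sqrt_mult)
  show "sqrt m * (((\<theta>' - lam') * \<Delta> - (\<theta> - lam) * \<Delta>) / (\<sigma> * sqrt \<Delta>)) = (u - w) / \<sigma>"
    "sqrt m * (\<sigma>' * sqrt \<Delta> / (\<sigma> * sqrt \<Delta>) - 1) = v / \<sigma>"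
    "m * ((lam' * \<Delta> - lam * \<Delta>)\<^sup>2 / (lam * \<Delta>)) = w\<^sup>2 / lam"
    unfolding \<theta>'_def \<sigma>'_def lam'_def sqrt unfolding p(2) q(2)
    using p(1) q(1) assms(3,4) by (simp_all add: field_simps power2_eq_square)
qed

lemma local_alternatives_drift_diffusion_intensity:
  fixes \<Delta> :: "nat \<Rightarrow> real" and \<sigma> lam \<theta> u v w :: real
  assumes \<Delta>: "\<And>n. \<Delta> n > 0" "\<Delta> \<longlonglongrightarrow> 0" "filterlim (\<lambda>n. real n * \<Delta> n) at_top sequentially"
    and \<sigma>: "\<sigma> > 0" and lam: "lam > 0"
  defines "\<theta>' \<equiv> \<lambda>n. \<theta> + u / sqrt (real n * \<Delta> n)" and "\<sigma>' \<equiv> \<lambda>n. \<sigma> + v / sqrt (real n)"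
    and "lam' \<equiv> \<lambda>n. lam + w / sqrt (real n * \<Delta> n)"
  shows "local_alternatives (\<lambda>n. (\<theta> - lam) * \<Delta> n) (\<lambda>n. \<sigma> * sqrt (\<Delta> n)) (\<lambda>n. lam * \<Delta> n)
      (\<lambda>n. (\<theta>' n - lam' n) * \<Delta> n) (\<lambda>n. \<sigma>' n * sqrt (\<Delta> n)) (\<lambda>n. lam' n * \<Delta> n)
      ((u - w) / \<sigma>) (v / \<sigma>) (w\<^sup>2 / lam)"
proof
  show "\<sigma> * sqrt (\<Delta> n) > 0" "lam * \<Delta> n > 0" for n
    using \<sigma> lam \<Delta>(1) by simp_all
  have "\<forall>\<^sub>F n in sequentially. lam' n > 0"
    unfolding lam'_def by (rule eventually_add_divide_pos[OF lam filterlim_compose[OF sqrt_at_top \<Delta>(3)]])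
  thus "\<forall>\<^sub>F n in sequentially. lam' n * \<Delta> n > 0"
    by eventually_elim (simp add: \<Delta>(1))
  note rates = increment_parameter_rates[OF _ \<Delta>(1) \<sigma> lam]
  show "(\<lambda>n. sqrt (real n) * (((\<theta>' n - lam' n) * \<Delta> n - (\<theta> - lam) * \<Delta> n) / (\<sigma> * sqrt (\<Delta> n)))) \<longlonglongrightarrow> (u - w) / \<sigma>"
    "(\<lambda>n. sqrt (real n) * (\<sigma>' n * sqrt (\<Delta> n) / (\<sigma> * sqrt (\<Delta> n)) - 1)) \<longlonglongrightarrow> v / \<sigma>"
    "(\<lambda>n. real n * ((lam' n * \<Delta> n - lam * \<Delta> n)\<^sup>2 / (lam * \<Delta> n))) \<longlonglongrightarrow> w\<^sup>2 / lam"
    unfolding \<theta>'_def \<sigma>'_def lam'_def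
    by (rule tendsto_eventually, use eventually_gt_at_top[of 0] in eventually_elim, rule rates, simp)+
  show "filterlim (\<lambda>n. real n * (lam * \<Delta> n)) at_top sequentially"
    using filterlim_tendsto_pos_mult_at_top[OF tendsto_const lam \<Delta>(3)] by (simp add: mult.left_commute)
  have "(\<lambda>n. \<sigma> * sqrt (\<Delta> n)) \<longlonglongrightarrow> \<sigma> * sqrt 0"
    by (intro tendsto_intros \<Delta>(2))
  thus "(\<lambda>n. \<sigma> * sqrt (\<Delta> n)) \<longlonglongrightarrow> 0" by simp
  have "(\<sigma> * sqrt (\<Delta> n))\<^sup>2 / (lam * \<Delta> n) = \<sigma>\<^sup>2 / lam" for n
    using \<Delta>(1)[of n] by (simp add: power_mult_distrib)
  thus "Bseq (\<lambda>n. (\<sigma> * sqrt (\<Delta> n))\<^sup>2 / (lam * \<Delta> n))" by simp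
qed

lemma quad_form_Fisher:
  assumes "\<sigma> > 0" "lam > 0"
  shows "quad_form (Fisher \<sigma> lam) (\<lambda>i. if i = 0 then u else if i = 1 then v else w) =
    ((u - w) / \<sigma>)\<^sup>2 + 2 * (v / \<sigma>)\<^sup>2 + w\<^sup>2 / lam"
  unfolding quad_form_def Fisher_def using assms by (simp add: eval_nat_numeral field_simps)

theorem theorem1:
  fixes M :: "'a measure" and B N :: "real \<Rightarrow> 'a \<Rightarrow> real"
    and \<Delta> :: "nat \<Rightarrow> real" and x \<theta> \<sigma> lam u v w :: real
  assumes "\<forall>n. 0 < \<Delta> n \<and> \<Delta> n \<le> 1"
    and "\<Delta> \<longlonglongrightarrow> 0"
    and "filterlim (\<lambda>n. real n * \<Delta> n) at_top sequentially"
    and "\<sigma> > 0" and "lam > 0"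
    and "bm_poisson M B N lam"
  defines "X \<equiv> (\<lambda>t \<omega>. x + \<theta> * t + \<sigma> * B t \<omega> + N t \<omega> - lam * t)"
    and "\<theta>n \<equiv> (\<lambda>n::nat. \<theta> + u / sqrt (real n * \<Delta> n))"
    and "\<sigma>n \<equiv> (\<lambda>n::nat. \<sigma> + v / sqrt (real n))"
    and "lamn \<equiv> (\<lambda>n::nat. lam + w / sqrt (real n * \<Delta> n))"
  shows "weak_conv_m
           (\<lambda>n. distr M borel (\<lambda>\<omega>.
              ln (likelihood (\<theta>n n) (\<sigma>n n) (lamn n) (\<Delta> n) n (\<lambda>k. X (real k * \<Delta> n) \<omega>)
                  / likelihood \<theta> \<sigma> lam (\<Delta> n) n (\<lambda>k. X (real k * \<Delta> n) \<omega>))))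
           (lan_limit_law (quad_form (Fisher \<sigma> lam) (\<lambda>i. if i = 0 then u else if i = 1 then v else w)))"
proof -
  note \<sigma> = assms(4) and lam = assms(5) and bp = assms(6)
  have \<Delta>: "\<Delta> n > 0" for n using assms(1) by blast
  interpret local_alternatives "\<lambda>n. (\<theta> - lam) * \<Delta> n" "\<lambda>n. \<sigma> * sqrt (\<Delta> n)" "\<lambda>n. lam * \<Delta> n"
      "\<lambda>n. (\<theta>n n - lamn n) * \<Delta> n" "\<lambda>n. \<sigma>n n * sqrt (\<Delta> n)" "\<lambda>n. lamn n * \<Delta> n"
      "(u - w) / \<sigma>" "v / \<sigma>" "w\<^sup>2 / lam"
    unfolding \<theta>n_def \<sigma>n_def lamn_def
    by (rule local_alternatives_drift_diffusion_intensity[OF \<Delta> assms(2,3) \<sigma> lam])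
  define Y where "Y n i \<omega> = X (real (Suc i) * \<Delta> n) \<omega> - X (real i * \<Delta> n) \<omega>" for n i \<omega>
  have "X t \<omega> = x + \<theta> * t + \<sigma> * B t \<omega> + N t \<omega> - lam * t" for t \<omega>
    by (simp add: X_def)
  note increments = jump_diffusion_increments[OF bp lam \<sigma> \<Delta> this, folded Y_def]
  have "weak_conv_m (\<lambda>n. distr M borel (\<lambda>\<omega>. \<Sum>i<n. ln (observed_ratio n (Y n i \<omega>))))
      (lan_limit_law (((u - w) / \<sigma>)\<^sup>2 + 2 * (v / \<sigma>)\<^sup>2 + w\<^sup>2 / lam))"
    using lam by (intro weak_conv_m_log_density_ratio bm_poissonD(1)[OF bp] increments) simp
  moreover have "\<forall>\<^sub>F n in sequentially. \<sigma>n n > 0 \<and> lamn n > 0"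
    unfolding \<sigma>n_def lamn_def
    by (intro eventually_conj eventually_add_divide_pos \<sigma> lam filterlim_sqrt_real_at_top
        filterlim_compose[OF sqrt_at_top assms(3)])
  hence "\<forall>\<^sub>F n in sequentially. distr M borel (\<lambda>\<omega>. \<Sum>i<n. ln (observed_ratio n (Y n i \<omega>))) =
      distr M borel (\<lambda>\<omega>. ln (likelihood (\<theta>n n) (\<sigma>n n) (lamn n) (\<Delta> n) n (\<lambda>k. X (real k * \<Delta> n) \<omega>)
        / likelihood \<theta> \<sigma> lam (\<Delta> n) n (\<lambda>k. X (real k * \<Delta> n) \<omega>)))"
    by eventually_elim (simp add: ln_likelihood_ratio \<sigma> lam \<Delta> observed_ratio_def Y_def)
  ultimately show ?thesis
    unfolding quad_form_Fisher[OF \<sigma> lam] by (rule weak_conv_m_cong_eventually)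
qed

end
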